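(* Let $u:X\to\mathbb{C}$ be an $\mathcal{F}$-measurable function such that the weighted conditional type operator $T=M_{\bar u}EM_u$ is a bounded operator on $L^2(\mathcal{F})$, and let $S\in\mathcal{B}(L^2(\mathcal{F}))$. Let $P=P_{\mathcal{N}(EM_u)^{\perp}}$ be the orthogonal projection of $L^2(\mathcal{F})$ onto $\mathcal{N}(EM_u)^{\perp}$. Then $S\in\mathcal{D}_T$ if and only if $PSP=PS$ and $PSP\in\mathcal{D}_{M_{E(|u|^2)}}$.
   Context: $(X,\mathcal{F},\mu)$ is a complete $\sigma$-finite measure space, $\mathcal{A}\subseteq\mathcal{F}$ is a $\sigma$-subalgebra such that $(X,\mathcal{A},\mu|_{\mathcal{A}})$ is also $\sigma$-finite, and $L^2(\mathcal{F})=L^2(X,\mathcal{F},\mu)$ (complex-valued functions). $E=E^{\mathcal{A}}$ is the conditional expectation with respect to $\mathcal{A}$: for $f\ge0$ or $f\in L^2(\mathcal{F})$, $E(f)$ is the unique $\mathcal{A}$-measurable function with $\int_AE(f)\,d\mu=\int_Af\,d\mu$ for all $A\in\mathcal{A}$ (a measurable function is called conditionable if its conditional expectation exists). For $\mathcal{F}$-measurable $u,w:X\to\mathbb{C}$ such that, for all $f\in L^2(\mathcal{F})$, $uf$ is conditionable and $wE(uf)\in L^2(\mathcal{F})$, the weighted conditional type (WCT) operator is $M_wEM_u:L^2(\mathcal{F})\to L^2(\mathcal{F})$, $f\mapsto wE(uf)$. $M_g$ denotes multiplication by $g$ on $L^2(\mathcal{F})$. $\mathcal{N}(EM_u)=\{f\in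 L^2(\mathcal{F}):E(uf)=0\}$. For a bounded operator $A$ on a Hilbert space $\mathcal{H}$, the Deddens algebra $\mathcal{D}_A$ is the set of all $S\in\mathcal{B}(\mathcal{H})$ for which there is $M>0$ with $\|A^nSx\|\le M\|A^nx\|$ for all $n\in\mathbb{N}$, $x\in\mathcal{H}$. *)

theory Defs
  imports "HOL-Analysis.Analysis" "HOL-Probability.Conditional_Expectation"
begin

text \<open>
  Elements of \<open>L\<^sup>2(M)\<close> are represented by square-integrable functions, and equality in \<open>L\<^sup>2(M)\<close> is
  equality almost everywhere. Operators act on representatives; bounded operators respect
  equality almost everywhere by lemma \<open>bounded_op_cong\<close> below.
\<close>

definition L2 :: "'a measure \<Rightarrow> ('a \<Rightarrow> complex) set" where
  "L2 M = {f \<in> borel_measurable M. integrable M (\<lambda>x. (cmod (f x))\<^sup>2)}"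

definition L2_inner :: "'a measure \<Rightarrow> ('a \<Rightarrow> complex) \<Rightarrow> ('a \<Rightarrow> complex) \<Rightarrow> complex" where
  "L2_inner M f g = (LINT x|M. f x * cnj (g x))"

definition L2_norm :: "'a measure \<Rightarrow> ('a \<Rightarrow> complex) \<Rightarrow> real" where
  "L2_norm M f = sqrt (LINT x|M. (cmod (f x))\<^sup>2)"

type_synonym 'a operator = "('a \<Rightarrow> complex) \<Rightarrow> ('a \<Rightarrow> complex)"

definition op_eq :: "'a measure \<Rightarrow> 'a operator \<Rightarrow> 'a operator \<Rightarrow> bool" where
  "op_eq M S T \<longleftrightarrow> (\<forall>f\<in>L2 M. AE x in M. S f x = T f x)"

definition bounded_op :: "'a measure \<Rightarrow> 'a operator \<Rightarrow> bool" where
  "bounded_op M S \<longleftrightarrow>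
     (\<forall>f\<in>L2 M. S f \<in> L2 M) \<and>
     (\<forall>f\<in>L2 M. \<forall>g\<in>L2 M. AE x in M. S (\<lambda>y. f y + g y) x = S f x + S g x) \<and>
     (\<forall>f\<in>L2 M. \<forall>c. AE x in M. S (\<lambda>y. c * f y) x = c * S f x) \<and>
     (\<exists>C. \<forall>f\<in>L2 M. L2_norm M (S f) \<le> C * L2_norm M f)"

definition orth_compl :: "'a measure \<Rightarrow> ('a \<Rightarrow> complex) set \<Rightarrow> ('a \<Rightarrow> complex) set" where
  "orth_compl M K = {g \<in> L2 M. \<forall>h\<in>K. L2_inner M g h = 0}"

text \<open>
  Up to equality almost everywhere there is at most one \<open>g\<close> as below when \<open>K\<close> is a subspace, and
  exactly one when \<open>K\<close> is closed, so the choice operator only selects a representative.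
\<close>

definition orth_proj :: "'a measure \<Rightarrow> ('a \<Rightarrow> complex) set \<Rightarrow> 'a operator" where
  "orth_proj M K f = (SOME g. g \<in> K \<and> (\<lambda>x. f x - g x) \<in> orth_compl M K)"

definition deddens :: "'a measure \<Rightarrow> 'a operator \<Rightarrow> 'a operator set" where
  "deddens M A = {S. bounded_op M S \<and>
     (\<exists>C>0. \<forall>n::nat. \<forall>f\<in>L2 M. L2_norm M ((A ^^ n) (S f)) \<le> C * L2_norm M ((A ^^ n) f))}"

text \<open>
  In the following, the second measure \<open>A\<close> only serves to carry the sub-\<open>\<sigma>\<close>-algebra, as in
  \<open>nn_cond_exp\<close> and \<open>real_cond_exp\<close>. For a nonnegative function the conditional expectation always
  exists with values in \<open>[0,\<infinity>]\<close> (\<open>nn_cond_exp\<close>). A complex function \<open>f\<close> has a (finite-valued)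
  conditional expectation when the positive and negative parts of its real and imaginary parts do,
  that is, when \<open>E(|f|)\<close> is finite almost everywhere. \<open>f\<close> itself need not be integrable.
\<close>

definition conditionable :: "'a measure \<Rightarrow> 'a measure \<Rightarrow> ('a \<Rightarrow> complex) \<Rightarrow> bool" where
  "conditionable M A f \<longleftrightarrow> f \<in> borel_measurable M \<and>
     (AE x in M. nn_cond_exp M A (\<lambda>y. ennreal (cmod (f y))) x < \<infinity>)"

definition cond_exp :: "'a measure \<Rightarrow> 'a measure \<Rightarrow> ('a \<Rightarrow> complex) \<Rightarrow> ('a \<Rightarrow> complex)" where
  "cond_exp M A f x =
     Complex (real_cond_exp M A (\<lambda>y. Re (f y)) x) (real_cond_exp M A (\<lambda>y. Im (f y)) x)"

definition mult_op :: "('a \<Rightarrow> complex) \<Rightarrow> 'a operator" where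
  "mult_op g f = (\<lambda>x. g x * f x)"

definition wct_well_defined ::
    "'a measure \<Rightarrow> 'a measure \<Rightarrow> ('a \<Rightarrow> complex) \<Rightarrow> ('a \<Rightarrow> complex) \<Rightarrow> bool" where
  "wct_well_defined M A w u \<longleftrightarrow>
     w \<in> borel_measurable M \<and> u \<in> borel_measurable M \<and>
     (\<forall>f\<in>L2 M. conditionable M A (mult_op u f) \<and> mult_op w (cond_exp M A (mult_op u f)) \<in> L2 M)"

definition wct :: "'a measure \<Rightarrow> 'a measure \<Rightarrow> ('a \<Rightarrow> complex) \<Rightarrow> ('a \<Rightarrow> complex) \<Rightarrow> 'a operator" where
  "wct M A w u = mult_op w \<circ> cond_exp M A \<circ> mult_op u"

definition null_EM :: "'a measure \<Rightarrow> 'a measure \<Rightarrow> ('a \<Rightarrow> complex) \<Rightarrow> ('a \<Rightarrow> complex) set" where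
  "null_EM M A u = {f \<in> L2 M. AE x in M. cond_exp M A (mult_op u f) x = 0}"

lemma bounded_op_cong:
  assumes S: "bounded_op M S" and f: "f \<in> L2 M" and g: "g \<in> L2 M"
    and eq: "AE x in M. f x = g x"
  shows "AE x in M. S f x = S g x"
proof -
  let ?d = "\<lambda>x. f x - g x"
  have m: "f \<in> borel_measurable M" "g \<in> borel_measurable M"
    using f g by (auto simp: L2_def)
  have z: "AE x in M. (cmod (?d x))\<^sup>2 = 0" using eq by eventually_elim simp
  have "integrable M (\<lambda>x. (cmod (?d x))\<^sup>2) \<longleftrightarrow> integrable M (\<lambda>x. 0::real)"
    by (rule integrable_cong_AE) (use m z in auto)
  then have d: "?d \<in> L2 M" using m by (auto simp: L2_def)
  have "(LINT x|M. (cmod (?d x))\<^sup>2) = 0"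
    using integral_cong_AE[OF _ _ z] m by simp
  then have "L2_norm M ?d = 0" by (simp add: L2_norm_def)
  moreover obtain C where "\<forall>f\<in>L2 M. L2_norm M (S f) \<le> C * L2_norm M f"
    using S by (auto simp: bounded_op_def)
  ultimately have "L2_norm M (S ?d) \<le> 0" using d by fastforce
  then have "(LINT x|M. (cmod (S ?d x))\<^sup>2) \<le> 0" by (simp add: L2_norm_def)
  moreover have "0 \<le> (LINT x|M. (cmod (S ?d x))\<^sup>2)" by simp
  ultimately have "(LINT x|M. (cmod (S ?d x))\<^sup>2) = 0" by linarith
  moreover have "integrable M (\<lambda>x. (cmod (S ?d x))\<^sup>2)"
    using S d by (auto simp: bounded_op_def L2_def)
  ultimately have "AE x in M. (cmod (S ?d x))\<^sup>2 = 0"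
    by (subst (asm) integral_nonneg_eq_0_iff_AE) auto
  moreover have "AE x in M. S (\<lambda>y. g y + ?d y) x = S g x + S ?d x"
  proof -
    have "\<forall>f\<in>L2 M. \<forall>g\<in>L2 M. AE x in M. S (\<lambda>y. f y + g y) x = S f x + S g x"
      using S by (simp add: bounded_op_def)
    from bspec[OF bspec[OF this g] d] show ?thesis .
  qed
  ultimately show ?thesis by eventually_elim simp
qed

text \<open>
  The defining property of the conditional expectation. The integral over \<open>B\<close> is only
  required to exist on the set \<open>B\<close> in question, so \<open>f\<close> may be any function in \<open>L\<^sup>2(M)\<close>
  and \<open>B\<close> any set of finite measure.
\<close>

lemma (in sigma_finite_subalgebra) cond_exp_set_integral:
  assumes f [measurable]: "f \<in> borel_measurable M" and B [measurable]: "B \<in> sets F"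
    and int: "set_integrable M B f"
  shows "cond_exp M F f \<in> borel_measurable F"
    and "set_integrable M B (cond_exp M F f)"
    and "(LINT x:B|M. cond_exp M F f x) = (LINT x:B|M. f x)"
proof -
  show "cond_exp M F f \<in> borel_measurable F"
    unfolding cond_exp_def [abs_def] Complex_eq by measurable
  have i: "integrable M (\<lambda>x. indicat_real B x * Re (f x))" "integrable M (\<lambda>x. indicat_real B x * Im (f x))"
    using integrable_Re[OF int[unfolded set_integrable_def]] integrable_Im[OF int[unfolded set_integrable_def]]
    by simp_all
  note R = real_cond_exp_intg[OF i(1)] and I = real_cond_exp_intg[OF i(2)]
  show g: "set_integrable M B (cond_exp M F f)"
    unfolding set_integrable_def cond_exp_def Complex_eq
    using R(1) I(1) by (simp add: scaleR_conv_of_real algebra_simps flip: of_real_mult)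
  show "(LINT x:B|M. cond_exp M F f x) = (LINT x:B|M. f x)"
  proof (rule complex_eqI)
    show "Re (LINT x:B|M. cond_exp M F f x) = Re (LINT x:B|M. f x)"
      using R(2) int g by (simp add: set_lebesgue_integral_def set_integrable_def cond_exp_def flip: integral_Re integral_Im)
    show "Im (LINT x:B|M. cond_exp M F f x) = Im (LINT x:B|M. f x)"
      using I(2) int g by (simp add: set_lebesgue_integral_def set_integrable_def cond_exp_def flip: integral_Re integral_Im)
  qed
qed

end

theory Submission
  imports Defs
begin

text \<open>
  Write \<open>h = E(|u|\<^sup>2)\<close>. The projection onto \<open>N(E M\<^sub>u)\<^sup>\<bottom>\<close> is \<open>P f = cnj u * E(u f) / h\<close>, it commutes with
  multiplication by \<open>h\<close>, and \<open>T f = h * P f\<close>; boundedness of \<open>T\<close> forces \<open>h\<close> to be essentially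
  bounded. Hence \<open>T\<^sup>n = h\<^sup>n P\<close> for \<open>n \<ge> 1\<close>, and membership in the Deddens algebra of \<open>T\<close> becomes the
  estimate \<open>\<parallel>h\<^sup>n P S f\<parallel> \<le> C \<parallel>h\<^sup>n P f\<parallel>\<close>. For \<open>n = 1\<close> it gives \<open>P S (I - P) = 0\<close>, because \<open>h\<close> is injective
  on the range of \<open>P\<close>; once \<open>P S = P S P\<close>, replacing \<open>f\<close> by \<open>P f\<close> turns it into the estimate for
  multiplication by \<open>h\<close>.
\<close>

section \<open>Square-integrable functions and bounded operators\<close>

lemma L2_iff_nn_integral:
  "f \<in> L2 M \<longleftrightarrow> f \<in> borel_measurable M \<and> (\<integral>\<^sup>+x. ennreal ((cmod (f x))\<^sup>2) \<partial>M) < \<infinity>"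
  by (auto simp: L2_def integrable_iff_bounded)

lemma L2_measurable [measurable_dest]: "f \<in> L2 M \<Longrightarrow> f \<in> borel_measurable M"
  by (simp add: L2_def)

lemma L2_norm_nonneg: "0 \<le> L2_norm M f"
  by (simp add: L2_norm_def)

lemma ennreal_L2_norm_power2:
  "f \<in> L2 M \<Longrightarrow> ennreal ((L2_norm M f)\<^sup>2) = (\<integral>\<^sup>+x. ennreal ((cmod (f x))\<^sup>2) \<partial>M)"
  by (simp add: L2_norm_def L2_def nn_integral_eq_integral)

lemma L2_norm_cong_AE:
  assumes [measurable]: "f \<in> borel_measurable M" "g \<in> borel_measurable M"
    and "AE x in M. f x = g x"
  shows "L2_norm M f = L2_norm M g"
proof -
  have "AE x in M. (cmod (f x))\<^sup>2 = (cmod (g x))\<^sup>2"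
    using assms(3) by eventually_elim simp
  then show ?thesis
    unfolding L2_norm_def by (intro arg_cong[where f = sqrt] integral_cong_AE) auto
qed

lemma L2_norm_eq_0_iff:
  assumes "f \<in> L2 M"
  shows "L2_norm M f = 0 \<longleftrightarrow> (AE x in M. f x = 0)"
  using assms by (simp add: L2_norm_def L2_def integral_nonneg_eq_0_iff_AE)

text \<open>The estimate is between extended nonnegative integrals, so it makes sense before
  \<open>f\<close> is known to be square-integrable and yields membership and norm bound
  together.\<close>

lemma L2_norm_leI:
  assumes "f \<in> borel_measurable M" "g \<in> L2 M" "0 \<le> C"
    and le: "(\<integral>\<^sup>+x. ennreal ((cmod (f x))\<^sup>2) \<partial>M) \<le> ennreal (C\<^sup>2) * (\<integral>\<^sup>+x. ennreal ((cmod (g x))\<^sup>2) \<partial>M)"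
  shows "f \<in> L2 M" and "L2_norm M f \<le> C * L2_norm M g"
proof -
  have le': "(\<integral>\<^sup>+x. ennreal ((cmod (f x))\<^sup>2) \<partial>M) \<le> ennreal ((C * L2_norm M g)\<^sup>2)"
    using le by (simp add: ennreal_L2_norm_power2[OF assms(2), symmetric] power_mult_distrib ennreal_mult)
  then show f: "f \<in> L2 M"
    using assms(1) by (auto simp: L2_iff_nn_integral intro: le_less_trans)
  have "ennreal ((L2_norm M f)\<^sup>2) \<le> ennreal ((C * L2_norm M g)\<^sup>2)"
    using le' by (simp add: ennreal_L2_norm_power2[OF f])
  then have "(L2_norm M f)\<^sup>2 \<le> (C * L2_norm M g)\<^sup>2" by simp
  then show "L2_norm M f \<le> C * L2_norm M g"
    by (rule power2_le_imp_le) (simp add: assms(3) L2_norm_nonneg)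
qed

lemma L2_mult_bounded:
  assumes f: "f \<in> L2 M" and [measurable]: "a \<in> borel_measurable M"
    and a: "AE x in M. cmod (a x) \<le> c"
  shows "(\<lambda>x. a x * f x) \<in> L2 M"
\<comment> \<open>The constant is the absolute value of \<open>c\<close>, since \<open>c\<close> may
  be negative if \<open>M\<close> is a null measure.\<close>
proof (rule L2_norm_leI(1)[OF _ f abs_ge_zero])
  note [measurable] = L2_measurable[OF f]
  show "(\<lambda>x. a x * f x) \<in> borel_measurable M" by measurable
  have "(\<integral>\<^sup>+x. ennreal ((cmod (a x * f x))\<^sup>2) \<partial>M) \<le> (\<integral>\<^sup>+x. ennreal (\<bar>c\<bar>\<^sup>2) * ennreal ((cmod (f x))\<^sup>2) \<partial>M)"
  proof (rule nn_integral_mono_AE)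
    show "AE x in M. ennreal ((cmod (a x * f x))\<^sup>2) \<le> ennreal (\<bar>c\<bar>\<^sup>2) * ennreal ((cmod (f x))\<^sup>2)"
      using a
    proof eventually_elim
      case (elim x)
      then have "(cmod (a x))\<^sup>2 \<le> \<bar>c\<bar>\<^sup>2" by (intro power_mono) auto
      then show ?case
        by (auto simp: norm_mult power_mult_distrib ennreal_mult[symmetric] intro!: ennreal_leI mult_right_mono)
    qed
  qed
  also have "\<dots> = ennreal (\<bar>c\<bar>\<^sup>2) * (\<integral>\<^sup>+x. ennreal ((cmod (f x))\<^sup>2) \<partial>M)"
    by (rule nn_integral_cmult) measurable
  finally show "(\<integral>\<^sup>+x. ennreal ((cmod (a x * f x))\<^sup>2) \<partial>M) \<le> ennreal (\<bar>c\<bar>\<^sup>2) * (\<integral>\<^sup>+x. ennreal ((cmod (f x))\<^sup>2) \<partial>M)" .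
qed

lemma L2_cmult: "f \<in> L2 M \<Longrightarrow> (\<lambda>x. c * f x) \<in> L2 M"
  by (rule L2_mult_bounded[where c = "cmod c"]) auto

lemma L2_add:
  assumes "f \<in> L2 M" "g \<in> L2 M"
  shows "(\<lambda>x. f x + g x) \<in> L2 M"
proof -
  note [measurable] = assms[THEN L2_measurable]
  have "integrable M (\<lambda>x. (cmod (f x + g x))\<^sup>2)"
  proof (rule Bochner_Integration.integrable_bound)
    show "integrable M (\<lambda>x. 2 * (cmod (f x))\<^sup>2 + 2 * (cmod (g x))\<^sup>2)"
      using assms by (auto simp: L2_def)
    have "(cmod (a + b))\<^sup>2 \<le> 2 * (cmod a)\<^sup>2 + 2 * (cmod b)\<^sup>2" for a b
    proof -
      have "(cmod (a + b))\<^sup>2 \<le> (cmod a + cmod b)\<^sup>2"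
        by (intro power_mono norm_triangle_ineq) simp
      also have "\<dots> \<le> 2 * (cmod a)\<^sup>2 + 2 * (cmod b)\<^sup>2"
        using sum_squares_bound[of "cmod a" "cmod b"] by (simp add: power2_sum)
      finally show ?thesis .
    qed
    then show "AE x in M. norm ((cmod (f x + g x))\<^sup>2) \<le> norm (2 * (cmod (f x))\<^sup>2 + 2 * (cmod (g x))\<^sup>2)"
      by simp
  qed measurable
  then show ?thesis by (simp add: L2_def)
qed

lemma L2_diff: "f \<in> L2 M \<Longrightarrow> g \<in> L2 M \<Longrightarrow> (\<lambda>x. f x - g x) \<in> L2 M"
  using L2_add[OF _ L2_cmult[of g M "-1"], of f] by simp

lemma borel_measurable_cnj [measurable]:
  "f \<in> borel_measurable M \<Longrightarrow> (\<lambda>x. cnj (f x)) \<in> borel_measurable M"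
  by (rule borel_measurable_continuous_on[where f = cnj, simplified comp_def]) (auto intro: continuous_intros)

section \<open>Inner product, orthogonal complements and projections\<close>

lemma L2_mult_integrable:
  assumes "f \<in> L2 M" "g \<in> L2 M"
  shows "integrable M (\<lambda>x. f x * cnj (g x))"
proof (rule Bochner_Integration.integrable_bound)
  note [measurable] = assms[THEN L2_measurable]
  show "integrable M (\<lambda>x. (cmod (f x))\<^sup>2 + (cmod (g x))\<^sup>2)"
    using assms by (auto simp: L2_def)
  show "(\<lambda>x. f x * cnj (g x)) \<in> borel_measurable M"
    by (intro borel_measurable_times L2_measurable assms borel_measurable_cnj)
  have "cmod a * cmod b \<le> (cmod a)\<^sup>2 + (cmod b)\<^sup>2" for a b
    using sum_squares_bound[of "cmod a" "cmod b"] mult_nonneg_nonneg[of "cmod a" "cmod b", OF norm_ge_zero norm_ge_zero]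
    unfolding mult.assoc by linarith
  then show "AE x in M. norm (f x * cnj (g x)) \<le> norm ((cmod (f x))\<^sup>2 + (cmod (g x))\<^sup>2)"
    by (simp add: norm_mult)
qed

lemma L2_inner_diff_left:
  assumes "f \<in> L2 M" "g \<in> L2 M" "h \<in> L2 M"
  shows "L2_inner M (\<lambda>x. f x - g x) h = L2_inner M f h - L2_inner M g h"
  unfolding L2_inner_def
  using Bochner_Integration.integral_diff[OF L2_mult_integrable[OF assms(1,3)] L2_mult_integrable[OF assms(2,3)]]
  by (simp add: left_diff_distrib)

lemma L2_inner_commute: "L2_inner M f g = cnj (L2_inner M g f)"
proof -
  have "cnj (L2_inner M g f) = (LINT x|M. cnj (g x * cnj (f x)))"
    unfolding L2_inner_def by (rule Bochner_Integration.integral_cnj[symmetric])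
  then show ?thesis by (simp add: L2_inner_def mult.commute)
qed

lemma L2_inner_self: "L2_inner M f f = of_real ((L2_norm M f)\<^sup>2)"
  by (simp add: L2_inner_def L2_norm_def complex_norm_square[symmetric] integral_complex_of_real del: of_real_power)

lemma orth_compl_diff:
  assumes "K \<subseteq> L2 M" "f \<in> orth_compl M K" "g \<in> orth_compl M K"
  shows "(\<lambda>x. f x - g x) \<in> orth_compl M K"
  using assms by (auto simp: orth_compl_def L2_diff L2_inner_diff_left subset_iff)

text \<open>Uniqueness of the orthogonal decomposition. It makes the choice in
  \<open>orth_proj\<close> harmless: exhibiting one decomposition of \<open>f\<close> determines the
  projection up to null sets.\<close>

lemma orth_proj_AE_eq:
  assumes K: "K \<subseteq> L2 M" "\<And>g h. g \<in> K \<Longrightarrow> h \<in> K \<Longrightarrow> (\<lambda>x. g x - h x) \<in> K"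
    and g: "g \<in> K" "(\<lambda>x. f x - g x) \<in> orth_compl M K"
  shows "orth_proj M K f \<in> K" and "AE x in M. orth_proj M K f x = g x"
proof -
  let ?p = "orth_proj M K f"
  have p: "?p \<in> K \<and> (\<lambda>x. f x - ?p x) \<in> orth_compl M K"
    unfolding orth_proj_def by (rule someI[of _ g]) (use g in simp)
  then show "?p \<in> K" by simp
  define d where "d = (\<lambda>x. ?p x - g x)"
  have d: "d \<in> K" unfolding d_def using K(2) p g by blast
  then have dL: "d \<in> L2 M" using K(1) by auto
  \<comment> \<open>The difference of the two candidates is also a difference of residuals
    orthogonal to \<open>K\<close>, so \<open>d\<close> is orthogonal to itself.\<close>
  have "d = (\<lambda>x. (f x - g x) - (f x - ?p x))" by (simp add: d_def)
  then have "L2_inner M d d = L2_inner M (\<lambda>x. f x - g x) d - L2_inner M (\<lambda>x. f x - ?p x) d"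
    using L2_inner_diff_left[of "\<lambda>x. f x - g x" M "\<lambda>x. f x - ?p x" d] g(2) p dL
    by (simp add: orth_compl_def)
  also have "\<dots> = 0" using g(2) p d by (auto simp: orth_compl_def)
  finally have "L2_norm M d = 0" by (simp add: L2_inner_self)
  then have "AE x in M. d x = 0" by (simp add: L2_norm_eq_0_iff[OF dL])
  then show "AE x in M. ?p x = g x" by (simp add: d_def)
qed

section \<open>Bounded operators, with linearity up to null sets\<close>

lemma bounded_op_L2: "bounded_op M S \<Longrightarrow> f \<in> L2 M \<Longrightarrow> S f \<in> L2 M"
  by (simp add: bounded_op_def)

lemma bounded_op_add:
  "bounded_op M S \<Longrightarrow> f \<in> L2 M \<Longrightarrow> g \<in> L2 M \<Longrightarrow> AE x in M. S (\<lambda>y. f y + g y) x = S f x + S g x"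
  unfolding bounded_op_def by blast

lemma bounded_op_cmult:
  "bounded_op M S \<Longrightarrow> f \<in> L2 M \<Longrightarrow> AE x in M. S (\<lambda>y. c * f y) x = c * S f x"
  unfolding bounded_op_def by blast

lemma bounded_op_diff:
  assumes "bounded_op M S" "f \<in> L2 M" "g \<in> L2 M"
  shows "AE x in M. S (\<lambda>y. f y - g y) x = S f x - S g x"
  using bounded_op_add[OF assms(1,2) L2_cmult[OF assms(3), of "-1"]]
    bounded_op_cmult[OF assms(1,3), of "-1"]
  by (simp, eventually_elim) simp

lemma bounded_op_bound:
  assumes "bounded_op M S"
  obtains C where "0 < C" "\<And>f. f \<in> L2 M \<Longrightarrow> L2_norm M (S f) \<le> C * L2_norm M f"
proof -
  obtain C where C: "\<And>f. f \<in> L2 M \<Longrightarrow> L2_norm M (S f) \<le> C * L2_norm M f"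
    using assms unfolding bounded_op_def by blast
  have "L2_norm M (S f) \<le> max 1 C * L2_norm M f" if "f \<in> L2 M" for f
    using C[OF that] mult_right_mono[OF max.cobounded2[of C 1] L2_norm_nonneg[of M f]] by linarith
  then show thesis by (intro that[of "max 1 C"]) auto
qed

lemma bounded_op_comp:
  assumes R: "bounded_op M R" and S: "bounded_op M S"
  shows "bounded_op M (R \<circ> S)"
  unfolding bounded_op_def comp_def
proof (intro conjI ballI allI)
  fix f assume f: "f \<in> L2 M"
  note Sf = bounded_op_L2[OF S f]
  show "R (S f) \<in> L2 M" by (rule bounded_op_L2[OF R Sf])
  \<comment> \<open>Linearity of \<open>S\<close> holds only almost everywhere;
    \<open>bounded_op_cong\<close> carries the equality through \<open>R\<close>.\<close>
  show "AE x in M. R (S (\<lambda>y. c * f y)) x = c * R (S f) x" for c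
    using bounded_op_cong[OF R bounded_op_L2[OF S L2_cmult[OF f]] L2_cmult[OF Sf] bounded_op_cmult[OF S f, of c]]
      bounded_op_cmult[OF R Sf, of c]
    by eventually_elim simp
  show "AE x in M. R (S (\<lambda>y. f y + g y)) x = R (S f) x + R (S g) x" if g: "g \<in> L2 M" for g
    using bounded_op_cong[OF R bounded_op_L2[OF S L2_add[OF f g]] L2_add[OF Sf bounded_op_L2[OF S g]]
        bounded_op_add[OF S f g]]
      bounded_op_add[OF R Sf bounded_op_L2[OF S g]]
    by eventually_elim simp
next
  obtain C where C: "0 < C" "\<And>f. f \<in> L2 M \<Longrightarrow> L2_norm M (R f) \<le> C * L2_norm M f"
    using bounded_op_bound[OF R] by blast
  obtain D where D: "\<And>f. f \<in> L2 M \<Longrightarrow> L2_norm M (S f) \<le> D * L2_norm M f"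
    using bounded_op_bound[OF S] by blast
  have "L2_norm M (R (S f)) \<le> C * D * L2_norm M f" if f: "f \<in> L2 M" for f
    using order_trans[OF C(2)[OF bounded_op_L2[OF S f]] mult_left_mono[OF D[OF f], of C]] C(1)
    by (simp add: mult.assoc)
  then show "\<exists>C. \<forall>f\<in>L2 M. L2_norm M (R (S f)) \<le> C * L2_norm M f" by blast
qed

text \<open>Moves boundedness from an operator given by a formula to one given by chosen
  representatives, such as \<open>orth_proj\<close>.\<close>

lemma bounded_op_cong_op:
  assumes S: "bounded_op M S" and R: "\<And>f. f \<in> L2 M \<Longrightarrow> R f \<in> L2 M"
    and eq: "\<And>f. f \<in> L2 M \<Longrightarrow> AE x in M. R f x = S f x"
  shows "bounded_op M R"
  unfolding bounded_op_def
proof (intro conjI ballI allI)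
  fix f assume f: "f \<in> L2 M"
  show "R f \<in> L2 M" by (rule R[OF f])
  show "AE x in M. R (\<lambda>y. c * f y) x = c * R f x" for c
    using eq[OF L2_cmult[OF f, of c]] eq[OF f] bounded_op_cmult[OF S f, of c] by eventually_elim simp
  show "AE x in M. R (\<lambda>y. f y + g y) x = R f x + R g x" if g: "g \<in> L2 M" for g
    using eq[OF L2_add[OF f g]] eq[OF f] eq[OF g] bounded_op_add[OF S f g] by eventually_elim simp
next
  have "L2_norm M (R f) = L2_norm M (S f)" if "f \<in> L2 M" for f
    using L2_norm_cong_AE[OF _ _ eq[OF that]] R[OF that] bounded_op_L2[OF S that]
    by (simp add: L2_def)
  then show "\<exists>C. \<forall>f\<in>L2 M. L2_norm M (R f) \<le> C * L2_norm M f"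
    using S by (auto simp: bounded_op_def)
qed

lemma mult_op_funpow: "(mult_op a ^^ n) f = (\<lambda>x. a x ^ n * f x)"
  by (induction n) (auto simp: mult_op_def mult.assoc)

section \<open>Deddens algebras of a multiplication composed with a commuting projection\<close>

text \<open>The operator-theoretic core, kept apart from conditional expectations: \<open>P\<close>
  is any bounded idempotent commuting with multiplication by \<open>a\<close>, and
  \<open>inj\<close> is the pointwise form of injectivity of that multiplication on the range of
  \<open>P\<close>.\<close>

lemma deddens_mult_proj_iff:
  assumes T: "bounded_op M T" and S: "bounded_op M S" and P: "bounded_op M P"
    and idem: "\<And>f. f \<in> L2 M \<Longrightarrow> AE x in M. P (P f) x = P f x"
    and [measurable]: "a \<in> borel_measurable M" and a: "AE x in M. cmod (a x) \<le> c"
    and comm: "\<And>f. f \<in> L2 M \<Longrightarrow> AE x in M. P (\<lambda>y. a y * f y) x = a x * P f x"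
    and TP: "\<And>f. f \<in> L2 M \<Longrightarrow> AE x in M. T f x = a x * P f x"
    and inj: "\<And>f. f \<in> L2 M \<Longrightarrow> AE x in M. a x = 0 \<longrightarrow> P f x = 0"
  shows "S \<in> deddens M T \<longleftrightarrow>
    op_eq M (P \<circ> S \<circ> P) (P \<circ> S) \<and> P \<circ> S \<circ> P \<in> deddens M (mult_op a)"
proof -
  note PL = bounded_op_L2[OF P] and SL = bounded_op_L2[OF S]
  have an: "AE x in M. cmod (a x ^ n) \<le> c ^ n" for n
    using a by eventually_elim (simp add: norm_power power_mono)
  have aL: "(\<lambda>x. a x ^ n * f x) \<in> L2 M" if "f \<in> L2 M" for n f
    by (rule L2_mult_bounded[OF that _ an]) measurable
  have comm_pow: "AE x in M. P (\<lambda>y. a y ^ n * f y) x = a x ^ n * P f x" if f: "f \<in> L2 M" for n f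
  proof (induction n)
    case (Suc n)
    then show ?case
      using comm[OF aL[OF f, of n]] by eventually_elim (simp add: mult.assoc)
  qed simp
  have TL: "(T ^^ n) f \<in> L2 M" if "f \<in> L2 M" for n f
    using that by (induction n) (auto intro: bounded_op_L2[OF T])
  \<comment> \<open>Stated for \<open>Suc n\<close> because the zeroth power is the identity and not
    \<open>P\<close>.\<close>
  have T_pow: "AE x in M. (T ^^ Suc n) f x = a x ^ Suc n * P f x" if f: "f \<in> L2 M" for n f
  proof (induction n)
    case 0
    then show ?case using TP[OF f] by simp
  next
    case (Suc n)
    have "AE x in M. (T ^^ Suc (Suc n)) f x = T (\<lambda>x. a x ^ Suc n * P f x) x"
      using bounded_op_cong[OF T TL[OF f] aL[OF PL[OF f]] Suc] by simp
    then show ?case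
      using TP[OF aL[OF PL[OF f], of "Suc n"]] comm_pow[OF PL[OF f], of "Suc n"] idem[OF f]
      by eventually_elim simp
  qed
  have T_norm: "L2_norm M ((T ^^ Suc n) f) = L2_norm M (\<lambda>x. a x ^ Suc n * P f x)" if "f \<in> L2 M" for n f
    by (rule L2_norm_cong_AE[OF _ _ T_pow[OF that]])
      (auto simp del: funpow.simps power_Suc intro!: L2_measurable[OF TL[OF that]] L2_measurable[OF aL[OF PL[OF that]]])
  have PSP: "bounded_op M (P \<circ> S \<circ> P)" by (intro bounded_op_comp P S)
  show ?thesis
  proof
    assume "S \<in> deddens M T"
    then obtain C where C: "0 < C"
      "\<And>n f. f \<in> L2 M \<Longrightarrow> L2_norm M ((T ^^ n) (S f)) \<le> C * L2_norm M ((T ^^ n) f)"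
      by (auto simp: deddens_def)
    have "AE x in M. P (S (P f)) x = P (S f) x" if f: "f \<in> L2 M" for f
    proof -
      \<comment> \<open>The component of \<open>f\<close> in the kernel of \<open>P\<close> is
        annihilated by \<open>T\<close>, so the estimate with exponent 1 forces
        \<open>T (S d)\<close> to vanish.\<close>
      define d where "d = (\<lambda>x. f x - P f x)"
      have d: "d \<in> L2 M" unfolding d_def by (intro L2_diff f PL)
      have "AE x in M. P d x = 0"
        using bounded_op_diff[OF P f PL[OF f]] idem[OF f] unfolding d_def by eventually_elim simp
      then have "AE x in M. T d x = 0" using TP[OF d] by eventually_elim simp
      then have "L2_norm M (T d) = 0" by (simp add: L2_norm_eq_0_iff[OF bounded_op_L2[OF T d]])
      then have "L2_norm M (T (S d)) = 0"
        using C(2)[OF d, of 1] L2_norm_nonneg[of M "T (S d)"] by simp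
      then have "AE x in M. T (S d) x = 0"
        by (simp add: L2_norm_eq_0_iff[OF bounded_op_L2[OF T SL[OF d]]])
      then have "AE x in M. P (S d) x = 0"
        using TP[OF SL[OF d]] inj[OF SL[OF d]] by eventually_elim auto
      moreover have "AE x in M. P (S d) x = P (\<lambda>x. S f x - S (P f) x) x"
        by (rule bounded_op_cong[OF P SL[OF d] L2_diff[OF SL[OF f] SL[OF PL[OF f]]]])
          (use bounded_op_diff[OF S f PL[OF f]] in \<open>simp add: d_def\<close>)
      ultimately show ?thesis
        using bounded_op_diff[OF P SL[OF f] SL[OF PL[OF f]]] by eventually_elim simp
    qed
    then have "op_eq M (P \<circ> S \<circ> P) (P \<circ> S)" by (simp add: op_eq_def)
    moreover obtain D where D: "0 < D" "\<And>f. f \<in> L2 M \<Longrightarrow> L2_norm M (P f) \<le> D * L2_norm M f"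
      using bounded_op_bound[OF P] by blast
    obtain E where E: "0 < E" "\<And>f. f \<in> L2 M \<Longrightarrow> L2_norm M ((P \<circ> S \<circ> P) f) \<le> E * L2_norm M f"
      using bounded_op_bound[OF PSP] by blast
    \<comment> \<open>For exponent 0 the bound \<open>E\<close> of \<open>P S P\<close> serves. For
      larger exponents \<open>C\<close> comes from the Deddens estimate at \<open>P f\<close> and
      \<open>D\<close> from the norm of \<open>P\<close>.\<close>
    have "L2_norm M (\<lambda>x. a x ^ n * P (S (P f)) x) \<le> max E (C * D) * L2_norm M (\<lambda>x. a x ^ n * f x)"
      if f: "f \<in> L2 M" for n f
    proof (cases n)
      case 0
      have "E * L2_norm M f \<le> max E (C * D) * L2_norm M f"
        by (intro mult_right_mono L2_norm_nonneg) simp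
      then show ?thesis using E(2)[OF f] 0 by simp
    next
      case (Suc m)
      have "L2_norm M (\<lambda>x. a x ^ n * P (S (P f)) x) = L2_norm M ((T ^^ n) (S (P f)))"
        using T_norm[OF SL[OF PL[OF f]]] Suc by simp
      also have "\<dots> \<le> C * L2_norm M ((T ^^ n) (P f))"
        by (rule C(2)[OF PL[OF f]])
      also have "L2_norm M ((T ^^ n) (P f)) = L2_norm M (\<lambda>x. a x ^ n * P (P f) x)"
        using T_norm[OF PL[OF f]] Suc by simp
      \<comment> \<open>Commutation brings the power of \<open>a\<close> inside \<open>P\<close>, so
        that the bound of \<open>P\<close> removes the projection on the right.\<close>
      also have "\<dots> = L2_norm M (P (\<lambda>x. a x ^ n * f x))"
      proof (rule L2_norm_cong_AE)
        show "AE x in M. a x ^ n * P (P f) x = P (\<lambda>x. a x ^ n * f x) x"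
          using idem[OF f] comm_pow[OF f, of n] by eventually_elim simp
      qed (intro L2_measurable aL PL f)+
      also have "C * \<dots> \<le> C * (D * L2_norm M (\<lambda>x. a x ^ n * f x))"
        using D(2)[OF aL[OF f]] C(1) by simp
      also have "\<dots> \<le> max E (C * D) * L2_norm M (\<lambda>x. a x ^ n * f x)"
        unfolding mult.assoc[symmetric] by (intro mult_right_mono L2_norm_nonneg) simp
      finally show ?thesis by simp
    qed
    moreover have "0 < max E (C * D)" using E(1) by simp
    ultimately have "P \<circ> S \<circ> P \<in> deddens M (mult_op a)"
      using PSP unfolding deddens_def mult_op_funpow by auto
    with \<open>op_eq M (P \<circ> S \<circ> P) (P \<circ> S)\<close>
    show "op_eq M (P \<circ> S \<circ> P) (P \<circ> S) \<and> P \<circ> S \<circ> P \<in> deddens M (mult_op a)" ..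
  next
    assume r: "op_eq M (P \<circ> S \<circ> P) (P \<circ> S) \<and> P \<circ> S \<circ> P \<in> deddens M (mult_op a)"
    then have eq: "AE x in M. P (S (P f)) x = P (S f) x" if "f \<in> L2 M" for f
      using that by (simp add: op_eq_def)
    obtain C where C: "0 < C"
      "\<And>n f. f \<in> L2 M \<Longrightarrow> L2_norm M (\<lambda>x. a x ^ n * P (S (P f)) x) \<le> C * L2_norm M (\<lambda>x. a x ^ n * f x)"
      using r by (auto simp: deddens_def mult_op_funpow)
    obtain E where E: "0 < E" "\<And>f. f \<in> L2 M \<Longrightarrow> L2_norm M (S f) \<le> E * L2_norm M f"
      using bounded_op_bound[OF S] by blast
    \<comment> \<open>\<open>E\<close> covers exponent 0, where the estimate is just boundedness of
      \<open>S\<close>; \<open>C\<close> covers all others.\<close>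
    have "L2_norm M ((T ^^ n) (S f)) \<le> max E C * L2_norm M ((T ^^ n) f)" if f: "f \<in> L2 M" for n f
    proof (cases n)
      case 0
      have "E * L2_norm M f \<le> max E C * L2_norm M f"
        by (intro mult_right_mono L2_norm_nonneg) simp
      then show ?thesis using E(2)[OF f] 0 by simp
    next
      case (Suc m)
      have "L2_norm M ((T ^^ n) (S f)) = L2_norm M (\<lambda>x. a x ^ n * P (S f) x)"
        using T_norm[OF SL[OF f]] Suc by simp
      \<comment> \<open>A second \<open>P\<close> is inserted so that the hypothesis can be used at
        \<open>P f\<close>; its right side is then the norm of a power of \<open>T\<close> at
        \<open>f\<close>.\<close>
      also have "\<dots> = L2_norm M (\<lambda>x. a x ^ n * P (S (P (P f))) x)"
      proof (rule L2_norm_cong_AE)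
        show "AE x in M. a x ^ n * P (S f) x = a x ^ n * P (S (P (P f))) x"
          using eq[OF f] eq[OF PL[OF f]] bounded_op_cong[OF bounded_op_comp[OF P S] PL[OF PL[OF f]] PL[OF f] idem[OF f]]
          by eventually_elim simp
      qed (intro L2_measurable aL PL SL f)+
      also have "\<dots> \<le> C * L2_norm M (\<lambda>x. a x ^ n * P f x)"
        by (rule C(2)[OF PL[OF f]])
      also have "\<dots> = C * L2_norm M ((T ^^ n) f)"
        using T_norm[OF f] Suc by simp
      also have "\<dots> \<le> max E C * L2_norm M ((T ^^ n) f)"
        by (intro mult_right_mono L2_norm_nonneg) simp
      finally show ?thesis .
    qed
    moreover have "0 < max E C" using E(1) by simp
    ultimately show "S \<in> deddens M T"
      using S by (auto simp: deddens_def)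
  qed
qed

section \<open>Complex conditional expectation\<close>

context sigma_finite_subalgebra
begin

lemma borel_measurable_complex_cond_exp [measurable]:
  "cond_exp M F f \<in> borel_measurable F" "cond_exp M F f \<in> borel_measurable M"
proof -
  show "cond_exp M F f \<in> borel_measurable F"
    unfolding cond_exp_def [abs_def] Complex_eq by measurable
  then show "cond_exp M F f \<in> borel_measurable M"
    by (rule measurable_from_subalg[OF subalg])
qed

lemma complex_cond_exp_cong:
  assumes [measurable]: "f \<in> borel_measurable M" "g \<in> borel_measurable M"
    and eq: "AE x in M. f x = g x"
  shows "AE x in M. cond_exp M F f x = cond_exp M F g x"
proof -
  have "AE x in M. real_cond_exp M F (\<lambda>x. Re (f x)) x = real_cond_exp M F (\<lambda>x. Re (g x)) x"
    by (rule real_cond_exp_cong) (use eq in auto)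
  moreover have "AE x in M. real_cond_exp M F (\<lambda>x. Im (f x)) x = real_cond_exp M F (\<lambda>x. Im (g x)) x"
    by (rule real_cond_exp_cong) (use eq in auto)
  ultimately show ?thesis by eventually_elim (simp add: cond_exp_def)
qed

lemma complex_cond_exp_uminus: "cond_exp M F (\<lambda>x. - f x) x = - cond_exp M F f x"
  by (simp add: cond_exp_def real_cond_exp_def complex_eq_iff)

text \<open>Reduces to the real rule. Each of the four products of real and imaginary parts is
  dominated by the modulus of \<open>g x * f x\<close>, hence integrable.\<close>

lemma complex_cond_exp_mult_integrable:
  assumes [measurable]: "g \<in> borel_measurable F" "f \<in> borel_measurable M"
    and int: "integrable M (\<lambda>x. g x * f x)"
  shows "AE x in M. cond_exp M F (\<lambda>x. g x * f x) x = g x * cond_exp M F f x"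
proof -
  have [measurable]: "g \<in> borel_measurable M"
    by (rule measurable_from_subalg[OF subalg]) measurable
  have part: "integrable M (\<lambda>x. p (g x) * q (f x))"
    if "\<And>z. \<bar>p z\<bar> \<le> cmod z" "\<And>z. \<bar>q z\<bar> \<le> cmod z"
      and [measurable]: "p \<in> borel_measurable borel" "q \<in> borel_measurable borel"
    for p q :: "complex \<Rightarrow> real"
    by (rule Bochner_Integration.integrable_bound[OF int])
      (auto simp: norm_mult abs_mult intro!: mult_mono that)
  note parts = part[of Re Re] part[of Re Im] part[of Im Re] part[of Im Im]
  have m: "AE x in M. real_cond_exp M F (\<lambda>x. p (g x) * q (f x)) x = p (g x) * real_cond_exp M F (\<lambda>x. q (f x)) x"
    if "integrable M (\<lambda>x. p (g x) * q (f x))"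
      and [measurable]: "p \<in> borel_measurable borel" "q \<in> borel_measurable borel"
    for p q :: "complex \<Rightarrow> real"
    by (rule real_cond_exp_mult) (use that in auto)
  have "AE x in M. real_cond_exp M F (\<lambda>x. Re (g x) * Re (f x) - Im (g x) * Im (f x)) x
    = Re (g x) * real_cond_exp M F (\<lambda>x. Re (f x)) x - Im (g x) * real_cond_exp M F (\<lambda>x. Im (f x)) x"
    using real_cond_exp_diff[OF parts(1) parts(4)] m[of Re Re, OF parts(1)] m[of Im Im, OF parts(4)]
    by (auto simp: abs_Re_le_cmod abs_Im_le_cmod)
  moreover have "AE x in M. real_cond_exp M F (\<lambda>x. Re (g x) * Im (f x) + Im (g x) * Re (f x)) x
    = Re (g x) * real_cond_exp M F (\<lambda>x. Im (f x)) x + Im (g x) * real_cond_exp M F (\<lambda>x. Re (f x)) x"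
    using real_cond_exp_add[OF parts(2) parts(3)] m[of Re Im, OF parts(2)] m[of Im Re, OF parts(3)]
    by (auto simp: abs_Re_le_cmod abs_Im_le_cmod)
  ultimately show ?thesis
    by eventually_elim (simp add: cond_exp_def complex_eq_iff)
qed

section \<open>Positive weights: from integrable to conditionable functions\<close>

lemma obtain_positive_integrable_subalg:
  obtains \<psi> :: "'a \<Rightarrow> real"
  where "\<psi> \<in> borel_measurable F" "\<And>x. 0 < \<psi> x" "integrable M \<psi>"
proof -
  interpret R: sigma_finite_measure "restr_to_subalg M F" by (rule sigma_fin_subalg)
  obtain \<psi> :: "'a \<Rightarrow> real" where "\<psi> \<in> borel_measurable (restr_to_subalg M F)" "\<And>x. 0 < \<psi> x"
    "integrable (restr_to_subalg M F) \<psi>"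
    using R.obtain_positive_integrable_function by metis
  then show thesis
    by (intro that[of \<psi>] measurable_in_subalg'[OF subalg] integrable_from_subalg[OF subalg]) auto
qed

text \<open>
  A conditionable function need not be integrable, but it becomes so after multiplication by a
  positive \<open>F\<close>-measurable weight; this transfers the algebraic rules from the integrable case.
\<close>

lemma conditionable_weight:
  assumes "conditionable M F f"
  obtains \<phi> :: "'a \<Rightarrow> real"
  where "\<phi> \<in> borel_measurable F" "\<And>x. 0 < \<phi> x" "integrable M (\<lambda>x. of_real (\<phi> x) * f x)"
proof -
  have [measurable]: "f \<in> borel_measurable M" using assms by (simp add: conditionable_def)
  obtain \<psi> :: "'a \<Rightarrow> real" where [measurable]: "\<psi> \<in> borel_measurable F" and \<psi>: "\<And>x. 0 < \<psi> x" "integrable M \<psi>"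
    using obtain_positive_integrable_subalg by metis
  define a where "a = nn_cond_exp M F (\<lambda>y. ennreal (cmod (f y)))"
  have [measurable]: "a \<in> borel_measurable F" by (simp add: a_def)
  \<comment> \<open>Chosen so that \<open>\<phi> * a\<close> is at most the integrable
    \<open>\<psi>\<close>; the summand 1 keeps the denominator positive. The default
    \<open>enn2real \<infinity> = 0\<close> occurs only on a null set.\<close>
  define \<phi> where "\<phi> x = \<psi> x / (1 + enn2real (a x))" for x
  have [measurable]: "\<phi> \<in> borel_measurable F" unfolding \<phi>_def[abs_def] by measurable
  have [measurable]: "\<phi> \<in> borel_measurable M" by (rule measurable_from_subalg[OF subalg]) measurable
  have pos: "0 < \<phi> x" for x using \<psi>(1)[of x] by (simp add: \<phi>_def add_pos_nonneg)
  have "(\<integral>\<^sup>+x. norm (of_real (\<phi> x) * f x) \<partial>M) = (\<integral>\<^sup>+x. ennreal (\<phi> x) * ennreal (cmod (f x)) \<partial>M)"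
    by (intro nn_integral_cong) (simp add: norm_mult ennreal_mult less_imp_le[OF pos] abs_of_pos[OF pos])
  also have "\<dots> = (\<integral>\<^sup>+x. ennreal (\<phi> x) * a x \<partial>M)"
    unfolding a_def by (rule nn_cond_exp_intg[symmetric]) measurable
  also have "\<dots> \<le> (\<integral>\<^sup>+x. ennreal (\<psi> x) \<partial>M)"
  proof (rule nn_integral_mono_AE)
    have "AE x in M. a x < \<infinity>" using assms by (simp add: conditionable_def a_def)
    then show "AE x in M. ennreal (\<phi> x) * a x \<le> ennreal (\<psi> x)"
    proof eventually_elim
      case (elim x)
      then obtain r where r: "0 \<le> r" "a x = ennreal r" by (cases "a x") auto
      have "\<phi> x * r \<le> \<psi> x" using r \<psi>(1)[of x] by (simp add: \<phi>_def field_simps)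
      then show ?case using r less_imp_le[OF pos[of x]] by (simp add: ennreal_mult[symmetric] ennreal_leI)
    qed
  qed
  also have "\<dots> < \<infinity>"
    using \<psi> by (simp add: nn_integral_eq_integral less_imp_le)
  finally have "integrable M (\<lambda>x. of_real (\<phi> x) * f x)"
    by (intro integrableI_bounded) auto
  then show thesis using pos by (intro that[of \<phi>]) auto
qed

lemma integrable_smaller_weight:
  fixes f :: "'a \<Rightarrow> complex" and \<phi> \<psi> :: "'a \<Rightarrow> real"
  assumes "integrable M (\<lambda>x. of_real (\<phi> x) * f x)" "\<And>x. cmod (g x) \<le> \<phi> x * cmod (f x)"
    and [measurable]: "g \<in> borel_measurable M"
  shows "integrable M g"
  by (rule Bochner_Integration.integrable_bound[OF assms(1)])
    (auto simp: norm_mult intro!: AE_I2 order_trans[OF assms(2)] mult_right_mono)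

text \<open>For a suitable weight \<open>\<psi>\<close>, the expectation of
  \<open>\<psi> g f\<close> is computed twice, once pulling out \<open>\<psi> g\<close> and once
  only \<open>\<psi>\<close>; then the positive \<open>\<psi>\<close> is cancelled.\<close>

lemma complex_cond_exp_mult:
  assumes [measurable]: "g \<in> borel_measurable F" and f: "conditionable M F f"
  shows "AE x in M. cond_exp M F (\<lambda>x. g x * f x) x = g x * cond_exp M F f x"
proof -
  have [measurable]: "f \<in> borel_measurable M" using f by (simp add: conditionable_def)
  have [measurable]: "g \<in> borel_measurable M" by (rule measurable_from_subalg[OF subalg]) measurable
  obtain \<phi> :: "'a \<Rightarrow> real" where [measurable]: "\<phi> \<in> borel_measurable F" and \<phi>: "\<And>x. 0 < \<phi> x"
    "integrable M (\<lambda>x. of_real (\<phi> x) * f x)"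
    using conditionable_weight[OF f] by metis
  \<comment> \<open>Shrinking the weight gives \<open>\<psi> |g| \<le> \<phi>\<close>, so that
    \<open>\<psi> g f\<close> is integrable.\<close>
  define \<psi> where "\<psi> x = \<phi> x / (1 + cmod (g x))" for x
  have [measurable]: "\<psi> \<in> borel_measurable F" unfolding \<psi>_def[abs_def] by measurable
  have [measurable]: "\<psi> \<in> borel_measurable M" by (rule measurable_from_subalg[OF subalg]) measurable
  have \<psi>0: "0 < \<psi> x" for x using \<phi>(1)[of x] by (simp add: \<psi>_def add_pos_nonneg)
  have int: "integrable M (\<lambda>x. of_real (\<psi> x) * g x * f x)"
  proof (rule integrable_smaller_weight[OF \<phi>(2)])
    fix x
    have "\<psi> x * cmod (g x) \<le> \<phi> x"
      using \<phi>(1)[of x] by (simp add: \<psi>_def divide_le_eq add_pos_nonneg algebra_simps)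
    then show "cmod (of_real (\<psi> x) * g x * f x) \<le> \<phi> x * cmod (f x)"
      using \<psi>0[of x] by (simp add: norm_mult mult_right_mono)
  qed measurable
  have "AE x in M. cond_exp M F (\<lambda>x. of_real (\<psi> x) * g x * f x) x = of_real (\<psi> x) * g x * cond_exp M F f x"
    by (rule complex_cond_exp_mult_integrable) (use int in auto)
  moreover have "AE x in M. cond_exp M F (\<lambda>x. of_real (\<psi> x) * (g x * f x)) x = of_real (\<psi> x) * cond_exp M F (\<lambda>x. g x * f x) x"
    by (rule complex_cond_exp_mult_integrable) (use int in \<open>auto simp: mult.assoc\<close>)
  ultimately show ?thesis
  proof eventually_elim
    case (elim x)
    then show ?case using \<psi>0[of x] by (simp add: mult.assoc)
  qed
qed

lemma complex_cond_exp_add: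
  assumes f: "conditionable M F f" and g: "conditionable M F g"
  shows "AE x in M. cond_exp M F (\<lambda>x. f x + g x) x = cond_exp M F f x + cond_exp M F g x"
proof -
  have [measurable]: "f \<in> borel_measurable M" "g \<in> borel_measurable M"
    using f g by (simp_all add: conditionable_def)
  obtain \<phi>1 :: "'a \<Rightarrow> real" where [measurable]: "\<phi>1 \<in> borel_measurable F" and \<phi>1: "\<And>x. 0 < \<phi>1 x"
    "integrable M (\<lambda>x. of_real (\<phi>1 x) * f x)"
    using conditionable_weight[OF f] by metis
  obtain \<phi>2 :: "'a \<Rightarrow> real" where [measurable]: "\<phi>2 \<in> borel_measurable F" and \<phi>2: "\<And>x. 0 < \<phi>2 x"
    "integrable M (\<lambda>x. of_real (\<phi>2 x) * g x)"
    using conditionable_weight[OF g] by metis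
  \<comment> \<open>The smaller of the two weights makes both functions integrable at once.\<close>
  define \<phi> where "\<phi> x = min (\<phi>1 x) (\<phi>2 x)" for x
  have [measurable]: "\<phi> \<in> borel_measurable F" unfolding \<phi>_def[abs_def] by measurable
  have [measurable]: "\<phi> \<in> borel_measurable M" by (rule measurable_from_subalg[OF subalg]) measurable
  have pos: "0 < \<phi> x" for x using \<phi>1(1) \<phi>2(1) by (simp add: \<phi>_def)
  have int: "integrable M (\<lambda>x. of_real (\<phi> x) * f x)" "integrable M (\<lambda>x. of_real (\<phi> x) * g x)"
    by (rule integrable_smaller_weight[OF \<phi>1(2)], simp add: norm_mult abs_of_pos[OF pos],
        simp add: \<phi>_def mult_right_mono, measurable)
      (rule integrable_smaller_weight[OF \<phi>2(2)], simp add: norm_mult abs_of_pos[OF pos],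
        simp add: \<phi>_def mult_right_mono, measurable)
  have sum: "AE x in M. cond_exp M F (\<lambda>x. of_real (\<phi> x) * f x + of_real (\<phi> x) * g x) x =
    cond_exp M F (\<lambda>x. of_real (\<phi> x) * f x) x + cond_exp M F (\<lambda>x. of_real (\<phi> x) * g x) x"
    using real_cond_exp_add[OF int[THEN integrable_Re]] real_cond_exp_add[OF int[THEN integrable_Im]]
    by eventually_elim (simp add: cond_exp_def complex_eq_iff)
  have eq: "AE x in M. cond_exp M F (\<lambda>x. of_real (\<phi> x) * k x) x = of_real (\<phi> x) * cond_exp M F k x"
    if "integrable M (\<lambda>x. of_real (\<phi> x) * k x)" and [measurable]: "k \<in> borel_measurable M" for k
    by (rule complex_cond_exp_mult_integrable) (use that in auto)
  have "integrable M (\<lambda>x. of_real (\<phi> x) * (f x + g x))"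
    using Bochner_Integration.integrable_add[OF int] by (simp add: distrib_left)
  from eq[OF this] eq[OF int(1)] eq[OF int(2)] sum
  have "AE x in M. of_real (\<phi> x) * cond_exp M F (\<lambda>x. f x + g x) x = of_real (\<phi> x) * (cond_exp M F f x + cond_exp M F g x)"
    by (auto simp: distrib_left)
  then show ?thesis
  proof eventually_elim
    case (elim x)
    then show ?case using pos[of x] by simp
  qed
qed

lemma conditionable_uminus: "conditionable M F f \<Longrightarrow> conditionable M F (\<lambda>x. - f x)"
  by (simp add: conditionable_def)

lemma complex_cond_exp_diff:
  assumes f: "conditionable M F f" and g: "conditionable M F g"
  shows "AE x in M. cond_exp M F (\<lambda>x. f x - g x) x = cond_exp M F f x - cond_exp M F g x"
  using complex_cond_exp_add[OF f conditionable_uminus[OF g]] by (simp add: complex_cond_exp_uminus)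

text \<open>The factor 2 is not optimal, but it spares the choice of a phase.\<close>

lemma cmod_complex_cond_exp_le:
  assumes [measurable]: "f \<in> borel_measurable M"
  shows "AE x in M. ennreal (cmod (cond_exp M F f x)) \<le> 2 * nn_cond_exp M F (\<lambda>x. ennreal (cmod (f x))) x"
proof -
  have le: "AE x in M. ennreal \<bar>real_cond_exp M F (\<lambda>x. p (f x)) x\<bar> \<le> nn_cond_exp M F (\<lambda>x. ennreal (cmod (f x))) x"
    if "\<And>z. \<bar>p z\<bar> \<le> cmod z" and [measurable]: "p \<in> borel_measurable borel" for p :: "complex \<Rightarrow> real"
  proof -
    have "AE x in M. nn_cond_exp M F (\<lambda>x. ennreal \<bar>p (f x)\<bar>) x \<le> nn_cond_exp M F (\<lambda>x. ennreal (cmod (f x))) x"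
      by (rule nn_cond_exp_mono) (auto intro!: ennreal_leI that)
    moreover have "AE x in M. ennreal \<bar>real_cond_exp M F (\<lambda>x. p (f x)) x\<bar> \<le> nn_cond_exp M F (\<lambda>x. ennreal \<bar>p (f x)\<bar>) x"
      by (rule real_cond_exp_abs) measurable
    ultimately show ?thesis by eventually_elim (rule order_trans)
  qed
  have "Re \<in> borel_measurable borel" "Im \<in> borel_measurable borel" by measurable
  from le[of Re, OF abs_Re_le_cmod this(1)] le[of Im, OF abs_Im_le_cmod this(2)]
  show ?thesis
  proof eventually_elim
    case (elim x)
    have "ennreal (cmod (cond_exp M F f x)) \<le> ennreal (\<bar>Re (cond_exp M F f x)\<bar> + \<bar>Im (cond_exp M F f x)\<bar>)"
      by (rule ennreal_leI) (rule cmod_le)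
    also have "\<dots> = ennreal \<bar>real_cond_exp M F (\<lambda>x. Re (f x)) x\<bar> + ennreal \<bar>real_cond_exp M F (\<lambda>x. Im (f x)) x\<bar>"
      by (simp add: cond_exp_def ennreal_plus)
    also have "\<dots> \<le> 2 * nn_cond_exp M F (\<lambda>x. ennreal (cmod (f x))) x"
      using add_mono[OF elim] by (simp add: mult_2)
    finally show ?case .
  qed
qed

section \<open>Nonnegative functions: zero sets and Cauchy-Schwarz\<close>

lemma complex_cond_exp_of_real_nonneg:
  assumes [measurable]: "f \<in> borel_measurable M" and "\<And>x. 0 \<le> f x"
  shows "AE x in M. cond_exp M F (\<lambda>x. of_real (f x)) x = of_real (enn2real (nn_cond_exp M F (\<lambda>x. ennreal (f x)) x))"
proof -
  \<comment> \<open>The real conditional expectation subtracts that of the negative part, here the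
    zero function, which is known to vanish only almost everywhere.\<close>
  have "AE x in M. 0 = nn_cond_exp M F (\<lambda>x. 0) x"
    by (rule nn_cond_exp_F_meas) simp
  then show ?thesis
    by eventually_elim (simp add: cond_exp_def real_cond_exp_def complex_eq_iff ennreal_neg assms(2))
qed

text \<open>Both conditions say that an integral over \<open>B\<close> is zero, and these integrals
  agree because \<open>B\<close> lies in \<open>F\<close>.\<close>

lemma nn_cond_exp_eq_0_on_iff:
  assumes [measurable]: "B \<in> sets F" "g \<in> borel_measurable M"
  shows "(AE x in M. x \<in> B \<longrightarrow> nn_cond_exp M F g x = 0) \<longleftrightarrow> (AE x in M. x \<in> B \<longrightarrow> g x = 0)"
proof -
  have [measurable]: "B \<in> sets M" using assms(1) subalg by (auto simp: subalgebra_def)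
  have i: "(\<integral>\<^sup>+x. indicator B x * k x \<partial>M) = 0 \<longleftrightarrow> (AE x in M. x \<in> B \<longrightarrow> k x = 0)"
    if [measurable]: "k \<in> borel_measurable M" for k :: "'a \<Rightarrow> ennreal"
    by (subst nn_integral_0_iff_AE) (auto simp: indicator_def)
  have "(\<integral>\<^sup>+x. indicator B x * nn_cond_exp M F g x \<partial>M) = (\<integral>\<^sup>+x. indicator B x * g x \<partial>M)"
    by (rule nn_cond_exp_intg) measurable
  then show ?thesis
    using i[of g] i[of "nn_cond_exp M F g"] by simp
qed

text \<open>
  Take conditional expectations in \<open>2 \<phi> |f g| \<le> \<phi>\<^sup>2 |f|\<^sup>2 + |g|\<^sup>2\<close> for the \<open>F\<close>-measurable function
  \<open>\<phi> = E(|f g|) / E(|f|\<^sup>2)\<close>.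
\<close>

lemma nn_cond_exp_Cauchy_Schwarz:
  fixes f g :: "'a \<Rightarrow> complex"
  assumes [measurable]: "f \<in> borel_measurable M" "g \<in> borel_measurable M"
    and fin: "AE x in M. nn_cond_exp M F (\<lambda>x. ennreal (cmod (f x * g x))) x < \<infinity>"
      "AE x in M. nn_cond_exp M F (\<lambda>x. ennreal ((cmod (f x))\<^sup>2)) x < \<infinity>"
  shows "AE x in M. (nn_cond_exp M F (\<lambda>x. ennreal (cmod (f x * g x))) x)\<^sup>2
    \<le> nn_cond_exp M F (\<lambda>x. ennreal ((cmod (f x))\<^sup>2)) x * nn_cond_exp M F (\<lambda>x. ennreal ((cmod (g x))\<^sup>2)) x"
proof -
  define a h G where "a = nn_cond_exp M F (\<lambda>x. ennreal (cmod (f x * g x)))"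
    and "h = nn_cond_exp M F (\<lambda>x. ennreal ((cmod (f x))\<^sup>2))"
    and "G = nn_cond_exp M F (\<lambda>x. ennreal ((cmod (g x))\<^sup>2))"
  have [measurable]: "a \<in> borel_measurable F" "h \<in> borel_measurable F" by (simp_all add: a_def h_def)
  have sub [measurable]: "{x \<in> space F. h x = 0} \<in> sets F" by measurable
  \<comment> \<open>Where \<open>h\<close> vanishes, so does \<open>f\<close>, hence
    \<open>f g\<close>, hence \<open>a\<close>. There \<open>\<phi>\<close> takes the default value
    of division by zero and carries no information.\<close>
  have "AE x in M. x \<in> {x \<in> space F. h x = 0} \<longrightarrow> ennreal ((cmod (f x))\<^sup>2) = 0"
    by (rule nn_cond_exp_eq_0_on_iff[OF sub, THEN iffD1]) (auto simp: h_def)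
  then have "AE x in M. x \<in> {x \<in> space F. h x = 0} \<longrightarrow> ennreal (cmod (f x * g x)) = 0"
    by eventually_elim (auto simp: norm_mult)
  then have "AE x in M. x \<in> {x \<in> space F. h x = 0} \<longrightarrow> a x = 0"
    unfolding a_def by (intro nn_cond_exp_eq_0_on_iff[OF sub, THEN iffD2]) auto
  then have h0: "AE x in M. h x = 0 \<longrightarrow> a x = 0"
    using AE_space by eventually_elim (use subalg in \<open>auto simp: subalgebra_def\<close>)
  define \<phi> where "\<phi> x = enn2real (a x) / enn2real (h x)" for x
  have [measurable]: "\<phi> \<in> borel_measurable F" unfolding \<phi>_def[abs_def] by measurable
  have [measurable]: "\<phi> \<in> borel_measurable M" by (rule measurable_from_subalg[OF subalg]) measurable
  have \<phi>: "0 \<le> \<phi> x" for x by (simp add: \<phi>_def)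
  have "AE x in M. ennreal (2 * \<phi> x) * a x = nn_cond_exp M F (\<lambda>x. ennreal (2 * \<phi> x) * ennreal (cmod (f x * g x))) x"
    unfolding a_def by (rule nn_cond_exp_prod) measurable
  moreover have "AE x in M. nn_cond_exp M F (\<lambda>x. ennreal (2 * \<phi> x) * ennreal (cmod (f x * g x))) x \<le>
    nn_cond_exp M F (\<lambda>x. ennreal ((\<phi> x)\<^sup>2) * ennreal ((cmod (f x))\<^sup>2) + ennreal ((cmod (g x))\<^sup>2)) x"
  proof (rule nn_cond_exp_mono)
    show "AE x in M. ennreal (2 * \<phi> x) * ennreal (cmod (f x * g x)) \<le>
      ennreal ((\<phi> x)\<^sup>2) * ennreal ((cmod (f x))\<^sup>2) + ennreal ((cmod (g x))\<^sup>2)"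
    proof (rule AE_I2)
      fix x
      have "2 * \<phi> x * cmod (f x * g x) \<le> (\<phi> x)\<^sup>2 * (cmod (f x))\<^sup>2 + (cmod (g x))\<^sup>2"
        using sum_squares_bound[of "\<phi> x * cmod (f x)" "cmod (g x)"]
        by (simp add: norm_mult power_mult_distrib mult.assoc)
      then show "ennreal (2 * \<phi> x) * ennreal (cmod (f x * g x)) \<le>
        ennreal ((\<phi> x)\<^sup>2) * ennreal ((cmod (f x))\<^sup>2) + ennreal ((cmod (g x))\<^sup>2)"
        using \<phi>[of x] by (simp add: ennreal_mult[symmetric] ennreal_plus[symmetric] del: ennreal_plus)
    qed
  qed measurable
  moreover have "AE x in M. nn_cond_exp M F (\<lambda>x. ennreal ((\<phi> x)\<^sup>2) * ennreal ((cmod (f x))\<^sup>2)) x + G x =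
    nn_cond_exp M F (\<lambda>x. ennreal ((\<phi> x)\<^sup>2) * ennreal ((cmod (f x))\<^sup>2) + ennreal ((cmod (g x))\<^sup>2)) x"
    unfolding G_def by (rule nn_cond_exp_sum) measurable
  moreover have "AE x in M. ennreal ((\<phi> x)\<^sup>2) * h x = nn_cond_exp M F (\<lambda>x. ennreal ((\<phi> x)\<^sup>2) * ennreal ((cmod (f x))\<^sup>2)) x"
    unfolding h_def by (rule nn_cond_exp_prod) measurable
  moreover have "AE x in M. a x < \<infinity>" "AE x in M. h x < \<infinity>"
    using fin by (simp_all add: a_def h_def)
  ultimately have "AE x in M. (a x)\<^sup>2 \<le> h x * G x"
    using h0
  proof eventually_elim
    case (elim x)
    obtain p where p: "0 \<le> p" "a x = ennreal p" using elim(5) by (cases "a x") auto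
    obtain q where q: "0 \<le> q" "h x = ennreal q" using elim(6) by (cases "h x") auto
    show ?case
    \<comment> \<open>If \<open>q = 0\<close>, then \<open>a x = 0\<close>; if \<open>G x\<close> is
      infinite, the right side is infinite unless \<open>h x = 0\<close>, when again
      \<open>a x = 0\<close>.\<close>
    proof (cases "q = 0 \<or> G x = \<infinity>")
      case True
      then show ?thesis
      proof
        assume "q = 0"
        then show ?thesis using elim(7) q by simp
      next
        assume G: "G x = \<infinity>"
        show ?thesis
          using elim(7) G by (cases "h x = 0") (auto simp: ennreal_mult_top)
      qed
    next
      case False
      then obtain r where r: "0 \<le> r" "G x = ennreal r" by (cases "G x") auto
      have q0: "0 < q" using False q by simp
      have \<phi>x: "\<phi> x = p / q" using p q by (simp add: \<phi>_def)
      \<comment> \<open>With \<open>\<phi> x = p / q\<close> this reads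
        \<open>2 p^2 / q \<le> p^2 / q + r\<close>, which is the claim after clearing
        \<open>q\<close>.\<close>
      have "ennreal (2 * \<phi> x) * a x \<le> ennreal ((\<phi> x)\<^sup>2) * h x + G x"
        using elim(1-4) by simp
      then have "2 * \<phi> x * p \<le> (\<phi> x)\<^sup>2 * q + r"
        using p q r \<phi>[of x] by (simp add: ennreal_mult[symmetric] ennreal_plus[symmetric] del: ennreal_plus)
      then have "p\<^sup>2 \<le> q * r"
        using q0 by (simp add: \<phi>x power2_eq_square field_simps)
      then show ?thesis
        using p q r by (simp add: ennreal_mult[symmetric] ennreal_power)
    qed
  qed
  then show ?thesis by (simp add: a_def h_def G_def)
qed

lemma integral_complex_cond_exp:
  assumes "integrable M f"
  shows "(LINT x|M. cond_exp M F f x) = (LINT x|M. f x)"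
proof -
  have "space M \<in> sets F" by (metis sets.top subalg subalgebra_def)
  moreover have "set_integrable M (space M) f"
    using assms by (simp add: set_integrable_def cong: Bochner_Integration.integrable_cong)
  ultimately have "(LINT x:space M|M. cond_exp M F f x) = (LINT x:space M|M. f x)"
    using assms by (intro cond_exp_set_integral) auto
  then show ?thesis by (simp add: set_lebesgue_integral_def cong: Bochner_Integration.integral_cong)
qed

end

section \<open>The operator \<open>f \<mapsto> cnj u * E(u f)\<close>\<close>

locale wct_adjoint = sigma_finite_subalgebra M F for M F :: "'a measure" +
  fixes u :: "'a \<Rightarrow> complex"
  assumes well_defined: "wct_well_defined M F (\<lambda>x. cnj (u x)) u"
    and bounded: "bounded_op M (wct M F (\<lambda>x. cnj (u x)) u)"
begin

abbreviation "T \<equiv> wct M F (\<lambda>x. cnj (u x)) u"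

text \<open>Real-valued so that level sets such as \<open>{h > C}\<close> can be formed.\<close>

definition h :: "'a \<Rightarrow> real" where
  "h = real_cond_exp M F (\<lambda>x. (cmod (u x))\<^sup>2)"

text \<open>Explicit candidate for the projection. Where \<open>h\<close> is zero the quotient is 0
  by convention, which is consistent since \<open>u\<close> vanishes there almost
  everywhere.\<close>

definition Q :: "'a operator" where
  "Q f x = cnj (u x) * (cond_exp M F (\<lambda>x. u x * f x) x / of_real (h x))"

section \<open>Finiteness and essential boundedness of the multiplier \<open>h\<close>\<close>

lemma measurable_u [measurable]: "u \<in> borel_measurable M"
  using well_defined by (simp add: wct_well_defined_def)

lemma measurable_h [measurable]: "h \<in> borel_measurable F" "h \<in> borel_measurable M"
  by (simp_all add: h_def)

text \<open>Holds at every point, since the imaginary part is a quantity minus itself; so it can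
  rewrite the multiplier inside operators.\<close>

lemma cond_exp_u_power2: "cond_exp M F (\<lambda>x. of_real ((cmod (u x))\<^sup>2)) = (\<lambda>x. of_real (h x))"
  by (simp add: cond_exp_def h_def complex_eq_iff fun_eq_iff real_cond_exp_def[of _ _ "\<lambda>x. 0"] del: of_real_power)

lemma T_eq: "T f x = cnj (u x) * cond_exp M F (\<lambda>x. u x * f x) x"
  by (simp add: wct_def mult_op_def)

lemma conditionable_mult_u: "f \<in> L2 M \<Longrightarrow> conditionable M F (\<lambda>x. u x * f x)"
  using well_defined by (auto simp: wct_well_defined_def mult_op_def)

text \<open>
  Applied to \<open>sgn (cnj u)\<close> times a weight \<open>\<phi>\<close>, well-definedness says that \<open>E(|u|\<^sup>2) E(|u| \<phi>)\<^sup>2\<close> is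
  integrable, and \<open>u\<close> vanishes where \<open>E(|u| \<phi>)\<close> does.
\<close>

lemma nn_cond_exp_u_power2_finite: "AE x in M. nn_cond_exp M F (\<lambda>x. ennreal ((cmod (u x))\<^sup>2)) x < \<infinity>"
proof -
  let ?h = "nn_cond_exp M F (\<lambda>x. ennreal ((cmod (u x))\<^sup>2))"
  obtain \<psi> :: "'a \<Rightarrow> real" where [measurable]: "\<psi> \<in> borel_measurable F" and \<psi>: "\<And>x. 0 < \<psi> x" "integrable M \<psi>"
    using obtain_positive_integrable_subalg by metis
  have [measurable]: "\<psi> \<in> borel_measurable M" by (rule measurable_from_subalg[OF subalg]) measurable
  \<comment> \<open>The phase makes \<open>u f\<close> nonnegative, and the square root gives
    \<open>|f|^2 \<le> \<psi>\<close>.\<close>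
  define f where "f x = of_real (sqrt (\<psi> x)) * sgn (cnj (u x))" for x
  have [measurable]: "f \<in> borel_measurable M" unfolding f_def[abs_def] sgn_div_norm by measurable
  have f: "f \<in> L2 M"
  proof -
    have "integrable M (\<lambda>x. (cmod (f x))\<^sup>2)"
      by (rule Bochner_Integration.integrable_bound[OF \<psi>(2)])
        (auto simp: f_def norm_mult power_mult_distrib norm_sgn less_imp_le[OF \<psi>(1)])
    then show ?thesis by (simp add: L2_def)
  qed
  define b where "b = nn_cond_exp M F (\<lambda>x. ennreal (cmod (u x * f x)))"
  have [measurable]: "b \<in> borel_measurable F" "b \<in> borel_measurable M" by (simp_all add: b_def)
  have b: "AE x in M. b x < \<infinity>"
    using conditionable_mult_u[OF f] by (simp add: conditionable_def b_def)
  have "u x * f x = of_real (cmod (u x * f x))" for x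
  proof -
    have "u x * f x = of_real (sqrt (\<psi> x)) * (u x * cnj (u x) / of_real (cmod (u x)))"
      by (simp add: f_def sgn_div_norm scaleR_conv_of_real field_simps)
    also have "\<dots> = of_real (sqrt (\<psi> x) * cmod (u x))"
      by (simp add: complex_norm_square[symmetric] power2_eq_square)
    finally show ?thesis using \<psi>(1)[of x] by (simp add: norm_mult)
  qed
  then have "AE x in M. cond_exp M F (\<lambda>x. u x * f x) x = of_real (enn2real (b x))"
    using complex_cond_exp_of_real_nonneg[of "\<lambda>x. cmod (u x * f x)"] unfolding b_def by simp
  then have T: "AE x in M. ennreal ((cmod (T f x))\<^sup>2) = ennreal ((enn2real (b x))\<^sup>2) * ennreal ((cmod (u x))\<^sup>2)"
    by eventually_elim (simp add: T_eq norm_mult power_mult_distrib ennreal_mult mult.commute)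
  \<comment> \<open>As \<open>b\<close> is measurable for \<open>F\<close>, \<open>|u|^2\<close> may
    be traded for its conditional expectation under the integral; finiteness of the norm of
    \<open>T f\<close> then bounds \<open>b^2 ?h\<close> almost everywhere.\<close>
  have "(\<integral>\<^sup>+x. ennreal ((enn2real (b x))\<^sup>2) * ?h x \<partial>M) = (\<integral>\<^sup>+x. ennreal ((enn2real (b x))\<^sup>2) * ennreal ((cmod (u x))\<^sup>2) \<partial>M)"
    by (rule nn_cond_exp_intg) measurable
  also have "\<dots> = (\<integral>\<^sup>+x. ennreal ((cmod (T f x))\<^sup>2) \<partial>M)"
    using T by (intro nn_integral_cong_AE, eventually_elim) simp
  also have "\<dots> < \<infinity>"
    using bounded_op_L2[OF bounded f] by (simp add: L2_iff_nn_integral)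
  finally have "AE x in M. ennreal ((enn2real (b x))\<^sup>2) * ?h x \<noteq> \<infinity>"
    by (intro nn_integral_PInf_AE) auto
  moreover have "AE x in M. b x = 0 \<longrightarrow> ?h x = 0"
  proof -
    have B [measurable]: "{x \<in> space F. b x = 0} \<in> sets F" by measurable
    have "AE x in M. x \<in> {x \<in> space F. b x = 0} \<longrightarrow> ennreal (cmod (u x * f x)) = 0"
      by (rule nn_cond_exp_eq_0_on_iff[OF B, THEN iffD1]) (auto simp: b_def)
    then have "AE x in M. x \<in> {x \<in> space F. b x = 0} \<longrightarrow> ennreal ((cmod (u x))\<^sup>2) = 0"
    proof eventually_elim
      case (elim x)
      then show ?case using \<psi>(1)[of x] by (auto simp: f_def norm_mult norm_sgn split: if_splits)
    qed
    then have "AE x in M. x \<in> {x \<in> space F. b x = 0} \<longrightarrow> ?h x = 0"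
      by (intro nn_cond_exp_eq_0_on_iff[OF B, THEN iffD2]) auto
    then show ?thesis
      using AE_space by eventually_elim (use subalg in \<open>auto simp: subalgebra_def\<close>)
  qed
  ultimately show ?thesis
    using b
  proof eventually_elim
    case (elim x)
    show ?case
    proof (cases "b x = 0")
      case False
      \<comment> \<open>Finiteness of \<open>b x\<close> matters here: \<open>enn2real\<close> would
        send an infinite value to 0.\<close>
      then have "0 < enn2real (b x)" using elim(3) by (simp add: enn2real_positive_iff zero_less_iff_neq_zero)
      then have "ennreal ((enn2real (b x))\<^sup>2) \<noteq> 0" by simp
      then show ?thesis using elim(1) by (auto simp: ennreal_mult_eq_top_iff less_top[symmetric])
    qed (use elim in simp)
  qed
qed

lemma ennreal_h: "AE x in M. nn_cond_exp M F (\<lambda>x. ennreal ((cmod (u x))\<^sup>2)) x = ennreal (h x)"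
proof -
  have "AE x in M. complex_of_real (h x) = of_real (enn2real (nn_cond_exp M F (\<lambda>x. ennreal ((cmod (u x))\<^sup>2)) x))"
    using complex_cond_exp_of_real_nonneg[of "\<lambda>x. (cmod (u x))\<^sup>2"] unfolding cond_exp_u_power2 by simp
  with nn_cond_exp_u_power2_finite show ?thesis
    by eventually_elim (simp add: less_top)
qed

lemma h_nonneg: "AE x in M. 0 \<le> h x"
  unfolding h_def by (rule real_cond_exp_pos) auto

lemma u_eq_0_where_h: "AE x in M. h x = 0 \<longrightarrow> u x = 0"
proof -
  have B [measurable]: "{x \<in> space F. h x = 0} \<in> sets F" by measurable
  have "AE x in M. x \<in> {x \<in> space F. h x = 0} \<longrightarrow> nn_cond_exp M F (\<lambda>x. ennreal ((cmod (u x))\<^sup>2)) x = 0"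
    using ennreal_h by eventually_elim simp
  then have "AE x in M. x \<in> {x \<in> space F. h x = 0} \<longrightarrow> ennreal ((cmod (u x))\<^sup>2) = 0"
    by (subst (asm) nn_cond_exp_eq_0_on_iff[OF B]) auto
  then show ?thesis
    using AE_space by eventually_elim (use subalg in \<open>auto simp: subalgebra_def\<close>)
qed

text \<open>The factor \<open>g\<close> is pulled out of the expectation of \<open>|u|^2 g\<close>,
  where \<open>|u|^2\<close> is conditionable because its expectation is finite.\<close>

lemma cond_exp_u_power2_mult:
  assumes [measurable]: "g \<in> borel_measurable F"
  shows "AE x in M. cond_exp M F (\<lambda>x. u x * (cnj (u x) * g x)) x = of_real (h x) * g x"
proof -
  have "conditionable M F (\<lambda>x. of_real ((cmod (u x))\<^sup>2))"
    using nn_cond_exp_u_power2_finite by (simp add: conditionable_def norm_power)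
  from complex_cond_exp_mult[OF assms this]
  have "AE x in M. cond_exp M F (\<lambda>x. g x * of_real ((cmod (u x))\<^sup>2)) x = of_real (h x) * g x"
    unfolding cond_exp_u_power2 by (simp add: mult.commute)
  moreover have "(\<lambda>x. g x * of_real ((cmod (u x))\<^sup>2)) = (\<lambda>x. u x * (cnj (u x) * g x))"
    unfolding complex_norm_square by (simp only: mult_ac)
  ultimately show ?thesis by simp
qed

text \<open>For \<open>F\<close>-measurable \<open>g\<close>, the operator multiplies \<open>cnj u * g\<close> by \<open>h\<close>; test on \<open>{h > C}\<close>.\<close>

lemma h_bounded: "\<exists>C. AE x in M. h x \<le> C"
proof -
  obtain C where C: "0 < C" "\<And>f. f \<in> L2 M \<Longrightarrow> L2_norm M (T f) \<le> C * L2_norm M f"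
    using bounded_op_bound[OF bounded] by blast
  obtain \<psi> :: "'a \<Rightarrow> real" where [measurable]: "\<psi> \<in> borel_measurable F" and \<psi>: "\<And>x. 0 < \<psi> x" "integrable M \<psi>"
    using obtain_positive_integrable_subalg by metis
  \<comment> \<open>The factor \<open>1 / (1 + h)\<close> gives \<open>g^2 h \<le> \<psi>\<close>,
    so that \<open>cnj u * g\<close> is square-integrable and supported on
    \<open>{h > C}\<close>.\<close>
  define g where "g x = (if C < h x then sqrt (\<psi> x) / (1 + h x) else 0)" for x
  have [measurable]: "g \<in> borel_measurable F" unfolding g_def[abs_def] by measurable
  have [measurable]: "g \<in> borel_measurable M" by (rule measurable_from_subalg[OF subalg]) measurable
  define f where "f x = cnj (u x) * of_real (g x)" for x
  have [measurable]: "f \<in> borel_measurable M" unfolding f_def[abs_def] by measurable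
  have "(\<integral>\<^sup>+x. ennreal ((cmod (f x))\<^sup>2) \<partial>M) = (\<integral>\<^sup>+x. ennreal ((g x)\<^sup>2) * ennreal ((cmod (u x))\<^sup>2) \<partial>M)"
    by (intro nn_integral_cong) (simp add: f_def norm_mult power_mult_distrib ennreal_mult mult.commute)
  also have "\<dots> = (\<integral>\<^sup>+x. ennreal ((g x)\<^sup>2) * nn_cond_exp M F (\<lambda>x. ennreal ((cmod (u x))\<^sup>2)) x \<partial>M)"
    by (rule nn_cond_exp_intg[symmetric]) measurable
  also have "\<dots> \<le> (\<integral>\<^sup>+x. ennreal (\<psi> x) \<partial>M)"
  proof (rule nn_integral_mono_AE)
    show "AE x in M. ennreal ((g x)\<^sup>2) * nn_cond_exp M F (\<lambda>x. ennreal ((cmod (u x))\<^sup>2)) x \<le> ennreal (\<psi> x)"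
      using ennreal_h h_nonneg
    proof eventually_elim
      case (elim x)
      have "(g x)\<^sup>2 * h x \<le> \<psi> x"
      proof (cases "C < h x")
        case True
        have "h x \<le> (1 + h x)\<^sup>2" using elim(2) by (simp add: power2_sum)
        then have "\<psi> x * h x \<le> \<psi> x * (1 + h x)\<^sup>2" using \<psi>(1)[of x] by simp
        then show ?thesis
          using True elim(2) \<psi>(1)[of x] by (simp add: g_def power_divide divide_le_eq)
      qed (use \<psi>(1)[of x] in \<open>simp add: g_def\<close>)
      then show ?case using elim by (simp add: ennreal_mult[symmetric] ennreal_leI)
    qed
  qed
  also have "\<dots> < \<infinity>" using \<psi> by (simp add: nn_integral_eq_integral less_imp_le)
  finally have f: "f \<in> L2 M" by (simp add: L2_iff_nn_integral)
  have "(\<lambda>x. complex_of_real (g x)) \<in> borel_measurable F" by measurable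
  from cond_exp_u_power2_mult[OF this]
  have Tf: "AE x in M. (cmod (T f x))\<^sup>2 = (h x)\<^sup>2 * (cmod (f x))\<^sup>2"
    unfolding f_def T_eq by eventually_elim (simp add: norm_mult power_mult_distrib)
  have i: "integrable M (\<lambda>x. (cmod (T f x))\<^sup>2)" "integrable M (\<lambda>x. (cmod (f x))\<^sup>2)"
    using bounded_op_L2[OF bounded f] f by (simp_all add: L2_def)
  have "(L2_norm M (T f))\<^sup>2 \<le> (C * L2_norm M f)\<^sup>2"
    by (intro power_mono C(2) f L2_norm_nonneg)
  \<comment> \<open>This integral is at most 0 by the norm bound, yet its integrand is
    \<open>(h^2 - C^2) |f|^2\<close>, nonnegative on the support of \<open>f\<close>; so the
    integrand vanishes almost everywhere.\<close>
  then have le: "(LINT x|M. (cmod (T f x))\<^sup>2 - C\<^sup>2 * (cmod (f x))\<^sup>2) \<le> 0"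
    using i by (simp add: L2_norm_def power_mult_distrib)
  have pt: "0 \<le> ((h x)\<^sup>2 - C\<^sup>2) * (cmod (f x))\<^sup>2" for x
  proof (cases "C < h x")
    case True
    then show ?thesis using C(1) by (intro mult_nonneg_nonneg) (auto intro: power_mono)
  qed (simp add: f_def g_def)
  have nn: "AE x in M. 0 \<le> (cmod (T f x))\<^sup>2 - C\<^sup>2 * (cmod (f x))\<^sup>2"
    using Tf by eventually_elim (use pt in \<open>simp add: left_diff_distrib\<close>)
  have int: "integrable M (\<lambda>x. (cmod (T f x))\<^sup>2 - C\<^sup>2 * (cmod (f x))\<^sup>2)"
    using i by auto
  have "(LINT x|M. (cmod (T f x))\<^sup>2 - C\<^sup>2 * (cmod (f x))\<^sup>2) = 0"
    using le integral_nonneg_AE[OF nn] by linarith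
  then have "AE x in M. (cmod (T f x))\<^sup>2 - C\<^sup>2 * (cmod (f x))\<^sup>2 = 0"
    using integral_nonneg_eq_0_iff_AE[OF int nn] by simp
  then have "AE x in M. C < h x \<longrightarrow> u x = 0"
    using Tf
  proof eventually_elim
    case (elim x)
    show ?case
    proof
      assume x: "C < h x"
      then have "C\<^sup>2 < (h x)\<^sup>2" using C(1) by (simp add: power_strict_mono)
      moreover have "((h x)\<^sup>2 - C\<^sup>2) * (cmod (f x))\<^sup>2 = 0"
        using elim by (simp add: left_diff_distrib)
      ultimately have "f x = 0" by simp
      moreover have "0 < g x" using x C(1) \<psi>(1)[of x] by (simp add: g_def)
      ultimately show "u x = 0" by (simp add: f_def)
    qed
  qed
  \<comment> \<open>On this set of \<open>F\<close> the function \<open>u\<close> vanishes, hence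
    also \<open>h\<close>, contradicting \<open>h > C > 0\<close>.\<close>
  then have "AE x in M. x \<in> {x \<in> space F. C < h x} \<longrightarrow> ennreal ((cmod (u x))\<^sup>2) = 0"
    by eventually_elim auto
  then have "AE x in M. x \<in> {x \<in> space F. C < h x} \<longrightarrow> nn_cond_exp M F (\<lambda>x. ennreal ((cmod (u x))\<^sup>2)) x = 0"
    by (intro nn_cond_exp_eq_0_on_iff[THEN iffD2]) auto
  then have "AE x in M. h x \<le> C"
    using AE_space ennreal_h
  proof eventually_elim
    case (elim x)
    then show ?case using C(1) subalg by (cases "C < h x") (auto simp: subalgebra_def)
  qed
  then show ?thesis ..
qed

section \<open>The operator \<open>Q\<close>: boundedness, idempotence and relation to
  \<open>T\<close>\<close>

lemma measurable_Q: "f \<in> borel_measurable M \<Longrightarrow> Q f \<in> borel_measurable M"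
  unfolding Q_def[abs_def] by measurable

text \<open>Conditioning turns \<open>|Q f|^2\<close> into \<open>|E(u f)|^2 / h\<close>, which
  Cauchy-Schwarz bounds by \<open>4 E(|f|^2)\<close>. The factor 4 is the square of the 2 in
  \<open>cmod_complex_cond_exp_le\<close>.\<close>

lemma Q_L2:
  assumes f: "f \<in> L2 M"
  shows "Q f \<in> L2 M" and "L2_norm M (Q f) \<le> 2 * L2_norm M f"
proof -
  note [measurable] = L2_measurable[OF f]
  let ?e = "cond_exp M F (\<lambda>x. u x * f x)"
  let ?a = "nn_cond_exp M F (\<lambda>x. ennreal (cmod (u x * f x)))"
  let ?G = "nn_cond_exp M F (\<lambda>x. ennreal ((cmod (f x))\<^sup>2))"
  define k where "k x = cmod (?e x / of_real (h x))" for x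
  have [measurable]: "k \<in> borel_measurable F" unfolding k_def[abs_def] by measurable
  have "(\<integral>\<^sup>+x. ennreal ((cmod (Q f x))\<^sup>2) \<partial>M) = (\<integral>\<^sup>+x. ennreal ((k x)\<^sup>2) * ennreal ((cmod (u x))\<^sup>2) \<partial>M)"
    by (intro nn_integral_cong)
      (simp add: Q_def k_def norm_mult norm_divide power_mult_distrib power_divide ennreal_mult[symmetric] mult.commute)
  also have "\<dots> = (\<integral>\<^sup>+x. ennreal ((k x)\<^sup>2) * nn_cond_exp M F (\<lambda>x. ennreal ((cmod (u x))\<^sup>2)) x \<partial>M)"
    by (rule nn_cond_exp_intg[symmetric]) measurable
  also have "\<dots> \<le> (\<integral>\<^sup>+x. ennreal 4 * ?G x \<partial>M)"
  proof (rule nn_integral_mono_AE)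
    have "AE x in M. ?a x < \<infinity>"
      using conditionable_mult_u[OF f] by (simp add: conditionable_def)
    then have "AE x in M. (?a x)\<^sup>2 \<le> nn_cond_exp M F (\<lambda>x. ennreal ((cmod (u x))\<^sup>2)) x * ?G x"
      using nn_cond_exp_u_power2_finite by (intro nn_cond_exp_Cauchy_Schwarz) measurable
    moreover have "AE x in M. ennreal (cmod (?e x)) \<le> 2 * ?a x"
      by (rule cmod_complex_cond_exp_le) measurable
    ultimately show "AE x in M. ennreal ((k x)\<^sup>2) * nn_cond_exp M F (\<lambda>x. ennreal ((cmod (u x))\<^sup>2)) x \<le> ennreal 4 * ?G x"
      using ennreal_h h_nonneg
    proof eventually_elim
      case (elim x)
      show ?case
      proof (cases "h x = 0")
        case False
        then have h: "0 < h x" using elim(4) by simp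
        have "ennreal ((cmod (?e x))\<^sup>2) = (ennreal (cmod (?e x)))\<^sup>2" by (simp add: ennreal_power)
        also have "\<dots> \<le> (2 * ?a x)\<^sup>2" by (intro power_mono elim(2)) simp
        also have "\<dots> = 4 * (?a x)\<^sup>2" by (simp add: power_mult_distrib)
        also have "\<dots> \<le> 4 * (ennreal (h x) * ?G x)"
          using elim(1,3) by (intro mult_left_mono) auto
        finally have le: "ennreal ((cmod (?e x))\<^sup>2) \<le> ennreal (h x) * (4 * ?G x)"
          by (simp add: mult_ac)
        have "ennreal ((k x)\<^sup>2) * ennreal (h x) = ennreal (1 / h x) * ennreal ((cmod (?e x))\<^sup>2)"
          using h by (simp add: k_def norm_divide power_divide ennreal_mult[symmetric] power2_eq_square field_simps)
        also have "\<dots> \<le> ennreal (1 / h x) * (ennreal (h x) * (4 * ?G x))"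
          by (intro mult_left_mono le) simp
        also have "\<dots> = 4 * ?G x"
          using h by (simp add: mult.assoc[symmetric] ennreal_mult[symmetric])
        finally show ?thesis using elim(3) by simp
      qed (simp add: k_def)
    qed
  qed
  also have "\<dots> = ennreal 4 * (\<integral>\<^sup>+x. ennreal ((cmod (f x))\<^sup>2) \<partial>M)"
    using nn_cond_exp_intg[of "\<lambda>_. ennreal 4" "\<lambda>x. ennreal ((cmod (f x))\<^sup>2)"] by (simp add: nn_integral_cmult)
  finally have le: "(\<integral>\<^sup>+x. ennreal ((cmod (Q f x))\<^sup>2) \<partial>M) \<le> ennreal (2\<^sup>2) * (\<integral>\<^sup>+x. ennreal ((cmod (f x))\<^sup>2) \<partial>M)"
    by simp
  show "Q f \<in> L2 M" "L2_norm M (Q f) \<le> 2 * L2_norm M f"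
    by (rule L2_norm_leI[OF _ f _ le]; simp add: measurable_Q)+
qed

text \<open>Constant \<open>g\<close> gives homogeneity of \<open>Q\<close>; \<open>g = h\<close>
  gives the commutation of the projection with the multiplier.\<close>

lemma Q_mult:
  assumes [measurable]: "g \<in> borel_measurable F" and f: "f \<in> L2 M"
  shows "AE x in M. Q (\<lambda>x. g x * f x) x = g x * Q f x"
proof -
  have eq: "(\<lambda>x. u x * (g x * f x)) = (\<lambda>x. g x * (u x * f x))" by (simp add: mult_ac)
  show ?thesis
    using complex_cond_exp_mult[OF assms(1) conditionable_mult_u[OF f]]
    by eventually_elim (simp add: Q_def eq)
qed

lemma bounded_op_Q: "bounded_op M Q"
  unfolding bounded_op_def
proof (intro conjI ballI allI)
  fix f assume f: "f \<in> L2 M"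
  show "Q f \<in> L2 M" by (rule Q_L2(1)[OF f])
  show "AE x in M. Q (\<lambda>y. c * f y) x = c * Q f x" for c
    by (rule Q_mult) (simp_all add: f)
  show "AE x in M. Q (\<lambda>y. f y + g y) x = Q f x + Q g x" if g: "g \<in> L2 M" for g
    using complex_cond_exp_add[OF conditionable_mult_u[OF f] conditionable_mult_u[OF g]]
    by eventually_elim (simp add: Q_def distrib_left add_divide_distrib)
next
  show "\<exists>C. \<forall>f\<in>L2 M. L2_norm M (Q f) \<le> C * L2_norm M f"
    using Q_L2(2) by blast
qed

text \<open>Allows the division by \<open>h\<close> in \<open>Q\<close> to be undone: on
  \<open>{h = 0}\<close> the function \<open>u f\<close> vanishes, hence so does
  \<open>E(|u f|)\<close>, which controls \<open>E(u f)\<close>.\<close>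

lemma cond_exp_eq_0_where_h:
  assumes [measurable]: "f \<in> borel_measurable M"
  shows "AE x in M. h x = 0 \<longrightarrow> cond_exp M F (\<lambda>x. u x * f x) x = 0"
proof -
  have B [measurable]: "{x \<in> space F. h x = 0} \<in> sets F" by measurable
  have "AE x in M. x \<in> {x \<in> space F. h x = 0} \<longrightarrow> ennreal (cmod (u x * f x)) = 0"
    using u_eq_0_where_h by eventually_elim simp
  then have "AE x in M. x \<in> {x \<in> space F. h x = 0} \<longrightarrow> nn_cond_exp M F (\<lambda>x. ennreal (cmod (u x * f x))) x = 0"
    by (intro nn_cond_exp_eq_0_on_iff[OF B, THEN iffD2]) auto
  moreover have "AE x in M. ennreal (cmod (cond_exp M F (\<lambda>x. u x * f x) x)) \<le> 2 * nn_cond_exp M F (\<lambda>x. ennreal (cmod (u x * f x))) x"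
    by (rule cmod_complex_cond_exp_le) measurable
  ultimately show ?thesis
    using AE_space by eventually_elim (use subalg in \<open>auto simp: subalgebra_def\<close>)
qed

text \<open>Since \<open>Q f\<close> depends on \<open>f\<close> only through \<open>E(u f)\<close>,
  this invariance yields idempotence, and it places \<open>f - Q f\<close> in the null
  space.\<close>

lemma cond_exp_Q:
  assumes f: "f \<in> L2 M"
  shows "AE x in M. cond_exp M F (\<lambda>x. u x * Q f x) x = cond_exp M F (\<lambda>x. u x * f x) x"
proof -
  have "AE x in M. cond_exp M F (\<lambda>x. u x * Q f x) x = of_real (h x) * (cond_exp M F (\<lambda>x. u x * f x) x / of_real (h x))"
    unfolding Q_def by (rule cond_exp_u_power2_mult) measurable
  then show ?thesis
    using cond_exp_eq_0_where_h[OF L2_measurable[OF f]] by eventually_elim auto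
qed

lemma Q_idem:
  assumes "f \<in> L2 M"
  shows "AE x in M. Q (Q f) x = Q f x"
  using cond_exp_Q[OF assms]
proof eventually_elim
  case (elim x)
  show ?case
    unfolding Q_def[of "Q f" x] elim by (rule Q_def[symmetric])
qed

text \<open>Where \<open>h\<close> is nonzero it cancels the denominator; elsewhere \<open>u\<close>
  is zero and both sides vanish.\<close>

lemma T_eq_Q: "f \<in> L2 M \<Longrightarrow> AE x in M. T f x = of_real (h x) * Q f x"
  using u_eq_0_where_h by eventually_elim (auto simp: T_eq Q_def)

section \<open>The null space and the identification of \<open>P\<close> with
  \<open>Q\<close>\<close>

lemma null_EM_subset: "null_EM M F u \<subseteq> L2 M"
  by (auto simp: null_EM_def)

lemma diff_Q_null_EM:
  assumes f: "f \<in> L2 M"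
  shows "(\<lambda>x. f x - Q f x) \<in> null_EM M F u"
proof -
  have "AE x in M. cond_exp M F (\<lambda>x. u x * (f x - Q f x)) x = 0"
    using complex_cond_exp_diff[OF conditionable_mult_u[OF f] conditionable_mult_u[OF Q_L2(1)[OF f]]]
      cond_exp_Q[OF f]
    by eventually_elim (simp add: right_diff_distrib)
  then show ?thesis
    by (simp add: null_EM_def mult_op_def L2_diff f Q_L2(1))
qed

text \<open>The inner product of \<open>g\<close> with \<open>Q f\<close> is the integral of
  \<open>k u g\<close> with \<open>k\<close> measurable for \<open>F\<close>; conditioning pulls
  \<open>k\<close> out and leaves \<open>E(u g) = 0\<close>.\<close>

lemma Q_orth_null_EM:
  assumes f: "f \<in> L2 M"
  shows "Q f \<in> orth_compl M (null_EM M F u)"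
proof -
  have "L2_inner M g (Q f) = 0" if g: "g \<in> null_EM M F u" for g
  proof -
    have gL: "g \<in> L2 M" and g0: "AE x in M. cond_exp M F (\<lambda>x. u x * g x) x = 0"
      using g by (auto simp: null_EM_def mult_op_def)
    define k where "k x = cnj (cond_exp M F (\<lambda>x. u x * f x) x / of_real (h x))" for x
    have [measurable]: "k \<in> borel_measurable F" unfolding k_def[abs_def] by measurable
    have eq: "(\<lambda>x. g x * cnj (Q f x)) = (\<lambda>x. k x * (u x * g x))"
      by (simp add: fun_eq_iff Q_def k_def)
    have "L2_inner M g (Q f) = (LINT x|M. cond_exp M F (\<lambda>x. k x * (u x * g x)) x)"
      unfolding L2_inner_def eq
      by (rule integral_complex_cond_exp[symmetric])
        (use L2_mult_integrable[OF gL Q_L2(1)[OF f]] in \<open>simp add: eq\<close>)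
    also have "\<dots> = (LINT x|M. 0)"
    proof (rule integral_cong_AE)
      show "AE x in M. cond_exp M F (\<lambda>x. k x * (u x * g x)) x = 0"
        using complex_cond_exp_mult[OF _ conditionable_mult_u[OF gL], of k] g0 by auto
    qed measurable
    finally show ?thesis by simp
  qed
  then show ?thesis
    using Q_L2(1)[OF f] L2_inner_commute[of M "Q f"] by (simp add: orth_compl_def)
qed

abbreviation "P \<equiv> orth_proj M (orth_compl M (null_EM M F u))"

text \<open>\<open>Q f\<close> lies in the complement of the null space and \<open>f - Q f\<close>
  in the null space, hence orthogonal to that complement. This exhibits the projection, and
  \<open>orth_proj_AE_eq\<close> identifies it.\<close>

lemma P_eq_Q:
  assumes f: "f \<in> L2 M"
  shows "P f \<in> L2 M" and "AE x in M. P f x = Q f x"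
proof -
  let ?K = "orth_compl M (null_EM M F u)"
  have K: "?K \<subseteq> L2 M" by (auto simp: orth_compl_def)
  have diff: "(\<lambda>x. g x - k x) \<in> ?K" if "g \<in> ?K" "k \<in> ?K" for g k
    using that by (rule orth_compl_diff[OF null_EM_subset])
  have "L2_inner M (\<lambda>x. f x - Q f x) k = 0" if "k \<in> ?K" for k
  proof -
    have "L2_inner M k (\<lambda>x. f x - Q f x) = 0"
      using that diff_Q_null_EM[OF f] by (simp add: orth_compl_def)
    then show ?thesis by (subst L2_inner_commute) simp
  qed
  then have perp: "(\<lambda>x. f x - Q f x) \<in> orth_compl M ?K"
    using L2_diff[OF f Q_L2(1)[OF f]] unfolding orth_compl_def by blast
  note P = orth_proj_AE_eq[OF K diff Q_orth_null_EM[OF f] perp]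
  show "P f \<in> L2 M" using P(1) K by blast
  show "AE x in M. P f x = Q f x" by (rule P(2))
qed

text \<open>The abstract equivalence with \<open>a = h\<close>. Each hypothesis is proved for
  \<open>Q\<close> and moved to \<open>P\<close>, whose chosen representatives agree with
  \<open>Q\<close> almost everywhere.\<close>

lemma deddens_T_iff:
  assumes S: "bounded_op M S"
  shows "S \<in> deddens M T \<longleftrightarrow>
    op_eq M (P \<circ> S \<circ> P) (P \<circ> S) \<and> P \<circ> S \<circ> P \<in> deddens M (mult_op (\<lambda>x. of_real (h x)))"
proof -
  obtain C where C: "AE x in M. h x \<le> C" using h_bounded by blast
  have P: "bounded_op M P"
    by (rule bounded_op_cong_op[OF bounded_op_Q]) (simp_all add: P_eq_Q)
  have hb: "AE x in M. cmod (of_real (h x)) \<le> C"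
    using C h_nonneg by eventually_elim simp
  show ?thesis
  proof (rule deddens_mult_proj_iff[OF bounded S P _ _ hb])
    fix f assume f: "f \<in> L2 M"
    note Pf = P_eq_Q[OF f]
    show "AE x in M. P (P f) x = P f x"
      using P_eq_Q(2)[OF Pf(1)] bounded_op_cong[OF bounded_op_Q Pf(1) Q_L2(1)[OF f] Pf(2)] Q_idem[OF f] Pf(2)
      by eventually_elim simp
    have hf: "(\<lambda>x. of_real (h x) * f x) \<in> L2 M"
      by (rule L2_mult_bounded[OF f _ hb]) measurable
    have "AE x in M. Q (\<lambda>x. of_real (h x) * f x) x = of_real (h x) * Q f x"
      by (rule Q_mult[OF _ f]) measurable
    then show "AE x in M. P (\<lambda>x. of_real (h x) * f x) x = of_real (h x) * P f x"
      using P_eq_Q(2)[OF hf] Pf(2) by eventually_elim simp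
    show "AE x in M. T f x = of_real (h x) * P f x"
      using T_eq_Q[OF f] Pf(2) by eventually_elim simp
    \<comment> \<open>The convention for division by zero makes \<open>Q f x\<close> equal to 0
      wherever \<open>h x = 0\<close>.\<close>
    show "AE x in M. complex_of_real (h x) = 0 \<longrightarrow> P f x = 0"
      using Pf(2) by eventually_elim (simp add: Q_def)
  qed measurable
qed

end

theorem theorem3p2:
  fixes M A :: "'a measure" and u :: "'a \<Rightarrow> complex" and S :: "'a operator"
  defines "T \<equiv> wct M A (\<lambda>x. cnj (u x)) u"
    and "P \<equiv> orth_proj M (orth_compl M (null_EM M A u))"
    and "Eu2 \<equiv> cond_exp M A (\<lambda>x. complex_of_real ((cmod (u x))\<^sup>2))"
  assumes "complete_measure M" and "sigma_finite_measure M"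
    and "sigma_finite_subalgebra M A"
    and "u \<in> borel_measurable M"
    and "wct_well_defined M A (\<lambda>x. cnj (u x)) u"
    and "bounded_op M T"
    and "bounded_op M S"
  shows "S \<in> deddens M T \<longleftrightarrow>
     op_eq M (P \<circ> S \<circ> P) (P \<circ> S) \<and> P \<circ> S \<circ> P \<in> deddens M (mult_op Eu2)"
proof -
  interpret wct_adjoint M A u
    using assms unfolding wct_adjoint_def wct_adjoint_axioms_def by blast
  show ?thesis
    unfolding T_def P_def Eu2_def cond_exp_u_power2
    using \<open>bounded_op M S\<close> by (rule deddens_T_iff)
qed

end
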